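(* Let $V$ be a real vector space of dimension $2n$, let $\omega_1,\omega_2$ be symplectic forms on $V$ and $g_1,g_2$ scalar products on $V$. The Heisenberg groups $\mathbb H(\omega_1,g_1)$ and $\mathbb H(\omega_2,g_2)$ are isometric if and only if there exists $\rho>0$ such that \[ \vec r_{\omega_1}(g_1)=\rho\,\vec r_{\omega_2}(g_2). \] In particular, there exist a map $F:\mathbb H(\omega_2,g_2)\to\mathbb H(\omega_1,g_1)$ of class $C^2$ and $\lambda>0$ such that \[ \triangle_{\mathbb H(\omega_2,g_2)}(u\circ F)=\lambda^2(\triangle_{\mathbb H(\omega_1,g_1)}u)\circ F\quad\text{for all }u\in C^2(\mathbb H(\omega_1,g_1)) \] if and only if $\vec r_{\omega_1}(g_1)=\rho\,\vec r_{\omega_2}(g_2)$ for some $\rho>0$.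
   Context: For a symplectic form $\omega$ (alternating nondegenerate bilinear form) and a scalar product $g$ on $V$, let $A_{\omega,g}\in GL(V)$ be defined by $\omega(v,w)=g(v,A_{\omega,g}w)$ for all $v,w$. The symplectic spectrum $\vec r_\omega(g)=(r_1,\dots,r_n)\in(0,\infty)^n$ is the $n$-tuple with $r_1\le\dots\le r_n$ such that $-r_1^4,\dots,-r_n^4$ are the eigenvalues of $A_{\omega,g}^2$ (each eigenvalue of $A^2_{\omega,g}$ has even multiplicity, counted once per pair). $\mathbb H(\omega)$ is the Lie group on $V\times\mathbb R$ with product $(v,s)*(w,t)=(v+w,s+t+\frac12\omega(v,w))$, whose Lie algebra is $V\times\mathbb R$ with bracket $[(v,s),(w,t)]=(0,\omega(v,w))$, stratified with first layer $V$. $\mathbb H(\omega,g)$ is the Carnot group $\mathbb H(\omega)$ with polarization $V$ and scalar product $g$ on $V$, endowed with its sub-Riemannian (Carnot–Carathéodory) distance; "isometric" means there is a distance-preserving bijection. For $v\in V$, $\tilde v$ is the left-invariant vector field with value $v$ at the identity, and the sub-Laplacian is $\triangle_{\mathbb H(\omega,g)}u=\sum_{i=1}^{2n}\tilde X_i^2u$ for a $g$-orthonormal basis $X_1,\dots,X_{2n}$ of $V$. *)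

theory Defs
  imports "HOL-Analysis.Analysis" "HOL-Library.Multiset"
begin

definition symplectic_form :: "('v::euclidean_space \<Rightarrow> 'v \<Rightarrow> real) \<Rightarrow> bool" where
  "symplectic_form \<omega> \<longleftrightarrow> bilinear \<omega> \<and> (\<forall>v. \<omega> v v = 0) \<and>
     (\<forall>v. (\<forall>w. \<omega> v w = 0) \<longrightarrow> v = 0)"

definition scalar_product :: "('v::euclidean_space \<Rightarrow> 'v \<Rightarrow> real) \<Rightarrow> bool" where
  "scalar_product g \<longleftrightarrow> bilinear g \<and> (\<forall>v w. g v w = g w v) \<and> (\<forall>v. v \<noteq> 0 \<longrightarrow> g v v > 0)"

definition A_op :: "('v::euclidean_space \<Rightarrow> 'v \<Rightarrow> real) \<Rightarrow> ('v \<Rightarrow> 'v \<Rightarrow> real) \<Rightarrow> 'v \<Rightarrow> 'v" where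
  "A_op \<omega> g = (THE A. linear A \<and> (\<forall>v w. \<omega> v w = g v (A w)))"

text \<open>Multiplicity of an eigenvalue c of A^2 (dimension of the eigenspace; A^2 is g-symmetric,
  hence diagonalizable).\<close>
definition eig_mult :: "('v::euclidean_space \<Rightarrow> 'v \<Rightarrow> real) \<Rightarrow> ('v \<Rightarrow> 'v \<Rightarrow> real) \<Rightarrow> real \<Rightarrow> nat" where
  "eig_mult \<omega> g c = dim {x. A_op \<omega> g (A_op \<omega> g x) = c *\<^sub>R x}"

definition sympl_spec_mset :: "('v::euclidean_space \<Rightarrow> 'v \<Rightarrow> real) \<Rightarrow> ('v \<Rightarrow> 'v \<Rightarrow> real) \<Rightarrow> real multiset" where
  "sympl_spec_mset \<omega> g =
     (\<Sum>r \<in> {r. r > 0 \<and> eig_mult \<omega> g (- (r ^ 4)) \<noteq> 0}.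
        replicate_mset (eig_mult \<omega> g (- (r ^ 4)) div 2) r)"

definition sympl_spec :: "('v::euclidean_space \<Rightarrow> 'v \<Rightarrow> real) \<Rightarrow> ('v \<Rightarrow> 'v \<Rightarrow> real) \<Rightarrow> real list" where
  "sympl_spec \<omega> g = sorted_list_of_multiset (sympl_spec_mset \<omega> g)"

definition heis_mult :: "('v::euclidean_space \<Rightarrow> 'v \<Rightarrow> real) \<Rightarrow> 'v \<times> real \<Rightarrow> 'v \<times> real \<Rightarrow> 'v \<times> real" where
  "heis_mult \<omega> p q = (fst p + fst q, snd p + snd q + \<omega> (fst p) (fst q) / 2)"

text \<open>Horizontal curve on [0,1] starting at p with control h (absolutely integrable):
  gamma' = (h, omega(x,h)/2), i.e. gamma' is the value at gamma of the left-invariant field of h.\<close>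
definition horiz_curve :: "('v::euclidean_space \<Rightarrow> 'v \<Rightarrow> real) \<Rightarrow> 'v \<times> real \<Rightarrow> (real \<Rightarrow> 'v) \<Rightarrow> real \<Rightarrow> 'v \<times> real" where
  "horiz_curve \<omega> p h t =
     (let x = (\<lambda>\<tau>. fst p + integral {0..\<tau>} h)
      in (x t, snd p + integral {0..t} (\<lambda>\<tau>. \<omega> (x \<tau>) (h \<tau>) / 2)))"

definition horiz_length :: "('v::euclidean_space \<Rightarrow> 'v \<Rightarrow> real) \<Rightarrow> (real \<Rightarrow> 'v) \<Rightarrow> real" where
  "horiz_length g h = integral {0..1} (\<lambda>t. sqrt (g (h t) (h t)))"

definition cc_dist :: "('v::euclidean_space \<Rightarrow> 'v \<Rightarrow> real) \<Rightarrow> ('v \<Rightarrow> 'v \<Rightarrow> real) \<Rightarrow> 'v \<times> real \<Rightarrow> 'v \<times> real \<Rightarrow> real" where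
  "cc_dist \<omega> g p q = Inf {horiz_length g h | h. h absolutely_integrable_on {0..1} \<and> horiz_curve \<omega> p h 1 = q}"

definition heis_isometric :: "('v::euclidean_space \<Rightarrow> 'v \<Rightarrow> real) \<Rightarrow> ('v \<Rightarrow> 'v \<Rightarrow> real) \<Rightarrow>
     ('v \<Rightarrow> 'v \<Rightarrow> real) \<Rightarrow> ('v \<Rightarrow> 'v \<Rightarrow> real) \<Rightarrow> bool" where
  "heis_isometric \<omega>1 g1 \<omega>2 g2 \<longleftrightarrow>
     (\<exists>F. bij F \<and> (\<forall>p q. cc_dist \<omega>2 g2 (F p) (F q) = cc_dist \<omega>1 g1 p q))"

definition C1_map :: "('a::euclidean_space \<Rightarrow> 'b::real_normed_vector) \<Rightarrow> bool" where
  "C1_map f \<longleftrightarrow> (\<exists>f'. (\<forall>p. (f has_derivative f' p) (at p)) \<and> (\<forall>v. continuous_on UNIV (\<lambda>p. f' p v)))"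

definition C2_map :: "('a::euclidean_space \<Rightarrow> 'b::real_normed_vector) \<Rightarrow> bool" where
  "C2_map f \<longleftrightarrow> (\<exists>f'. (\<forall>p. (f has_derivative f' p) (at p)) \<and> (\<forall>v. C1_map (\<lambda>p. f' p v)))"

definition lie_field :: "('v::euclidean_space \<Rightarrow> 'v \<Rightarrow> real) \<Rightarrow> 'v \<Rightarrow> ('v \<times> real \<Rightarrow> real) \<Rightarrow> 'v \<times> real \<Rightarrow> real" where
  "lie_field \<omega> v u p = deriv (\<lambda>t. u (heis_mult \<omega> p (t *\<^sub>R v, 0))) 0"

definition g_orthonormal_basis :: "('v::euclidean_space \<Rightarrow> 'v \<Rightarrow> real) \<Rightarrow> 'v set \<Rightarrow> bool" where
  "g_orthonormal_basis g B \<longleftrightarrow> finite B \<and> card B = DIM('v) \<and>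
     (\<forall>x\<in>B. \<forall>y\<in>B. g x y = (if x = y then 1 else 0))"

definition sub_laplacian :: "('v::euclidean_space \<Rightarrow> 'v \<Rightarrow> real) \<Rightarrow> ('v \<Rightarrow> 'v \<Rightarrow> real) \<Rightarrow>
     ('v \<times> real \<Rightarrow> real) \<Rightarrow> 'v \<times> real \<Rightarrow> real" where
  "sub_laplacian \<omega> g u p =
     (let B = (SOME B. g_orthonormal_basis g B) in \<Sum>X\<in>B. lie_field \<omega> X (lie_field \<omega> X u) p)"

end

theory Submission
  imports Defs "HOL-Real_Asymp.Real_Asymp"
begin

text \<open>
  All three conditions are equivalent to the existence of a linear bijection \<open>L\<close> of \<open>V\<close> that multiplies the
  scalar product by a positive factor and the symplectic form by a nonzero factor; by the normal form of
  skew maps, such an \<open>L\<close> exists exactly when the symplectic spectra are proportional.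

  An isometry \<open>F\<close> with \<open>F 0 = 0\<close> maps geodesic rays to geodesic rays, and these are horizontal lines. Since the
  Busemann function of the ray in direction \<open>v\<close> is \<open>(x, s) \<mapsto> - x \<bullet> v\<close>, \<open>F\<close> covers a linear isometry \<open>f\<close> of \<open>V\<close>
  and satisfies \<open>F (p * (v, 0)) = F p * (f v, 0)\<close>; evaluating \<open>F\<close> on commutators shows that \<open>f\<close> respects the
  symplectic forms up to a factor.

  If \<open>F\<close> intertwines the sub-Laplacians up to a factor, comparing principal symbols shows that its differential
  is horizontal and conformal at every point, and differentiating horizontality relates the symplectic forms.
\<close>

subsection \<open>Symplectic normal form\<close>

text \<open>Isometric groups have proportional rather than equal spectra because the distance does
  not normalise the centre: a linear isometry of \<open>V\<close> that multiplies the form by any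
  nonzero factor extends to the groups by rescaling the central coordinate, and a conformal factor
  can be removed by a dilation.

  An isometry is a mere map of metric spaces, so nothing may be differentiated, and geodesic
  segments say little since their projections may bend. Rays are better: a shortcut in the
  projection leaves only a central defect, and far out such a defect is cheap to repair. The same
  mechanism makes Busemann functions blind to the centre, which is how the metric alone determines
  the projection of \<open>F\<close>.

  For the sub-Laplacians, invertibility of the differential on \<open>V\<close> has to be derived:
  test functions control a linear map \<open>L\<close> only through its adjoint, and it is finite
  dimension that turns this into conformality of \<open>L\<close> itself.\<close>

lemma bilinear_simps:
  assumes "bilinear h"
  shows "h (x + y) z = h x z + h y z" "h z (x + y) = h z x + h z y"
    "h (c *\<^sub>R x) z = c *\<^sub>R h x z" "h z (c *\<^sub>R x) = c *\<^sub>R h z x"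
    "h (x - y) z = h x z - h y z" "h z (x - y) = h z x - h z y"
    "h (- x) z = - h x z" "h z (- x) = - h z x" "h 0 z = 0" "h z 0 = 0"
  using assms by (simp_all add: bilinear_ladd bilinear_radd bilinear_lmul bilinear_rmul
      bilinear_lsub bilinear_rsub bilinear_lneg bilinear_rneg bilinear_lzero bilinear_rzero)

lemma bilinear_sum_left: "bilinear h \<Longrightarrow> h (sum f S) z = (\<Sum>x\<in>S. h (f x) z)"
  and bilinear_sum_right: "bilinear h \<Longrightarrow> h z (sum f S) = (\<Sum>x\<in>S. h z (f x))"
  using linear_sum[of "\<lambda>x. h x z"] linear_sum[of "h z"] by (auto simp: bilinear_def)

lemma bilinear_pullback:
  assumes "bilinear h" "linear S" "linear T"
  shows "bilinear (\<lambda>v w. h (S v) (T w))"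
  using assms unfolding bilinear_def
  by (auto intro: linear_compose[unfolded o_def])

section \<open>Symplectic forms, scalar products and orthonormal frames\<close>

lemma symplectic_form_bilinear: "symplectic_form \<omega> \<Longrightarrow> bilinear \<omega>"
  and symplectic_form_self: "symplectic_form \<omega> \<Longrightarrow> \<omega> v v = 0"
  and symplectic_form_nondegenerate: "symplectic_form \<omega> \<Longrightarrow> (\<And>w. \<omega> v w = 0) \<Longrightarrow> v = 0"
  by (auto simp: symplectic_form_def)

lemma symplectic_form_skew:
  assumes "symplectic_form \<omega>" shows "\<omega> v w = - \<omega> w v"
proof -
  have "\<omega> (v + w) (v + w) = \<omega> v v + \<omega> v w + (\<omega> w v + \<omega> w w)"
    by (simp only: bilinear_simps[OF symplectic_form_bilinear[OF assms]])
  then show ?thesis by (simp add: symplectic_form_self[OF assms])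
qed

lemma scalar_product_bilinear: "scalar_product g \<Longrightarrow> bilinear g"
  and scalar_product_sym: "scalar_product g \<Longrightarrow> g v w = g w v"
  and scalar_product_pos: "scalar_product g \<Longrightarrow> v \<noteq> 0 \<Longrightarrow> g v v > 0"
  by (auto simp: scalar_product_def)

lemma scalar_product_inner: "scalar_product (\<bullet>)"
  by (simp add: scalar_product_def bilinear_conv_bounded_bilinear bounded_bilinear_inner inner_commute)

lemma orthonormal_expansion_coeff:
  assumes "scalar_product g" "finite B" "\<And>x y. x \<in> B \<Longrightarrow> y \<in> B \<Longrightarrow> g x y = (if x = y then 1 else 0)" "y \<in> B"
  shows "g (\<Sum>x\<in>B. u x *\<^sub>R x) y = u y"
proof -
  have "g (\<Sum>x\<in>B. u x *\<^sub>R x) y = (\<Sum>x\<in>B. u x * g x y)"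
    using scalar_product_bilinear[OF assms(1)]
    by (simp add: bilinear_sum_left bilinear_simps)
  also have "\<dots> = (\<Sum>x\<in>B. if x = y then u y else 0)"
    by (rule sum.cong) (use assms in auto)
  also have "\<dots> = u y" using assms by simp
  finally show ?thesis .
qed

lemma orthonormal_independent:
  assumes "scalar_product g" "finite B" "\<And>x y. x \<in> B \<Longrightarrow> y \<in> B \<Longrightarrow> g x y = (if x = y then 1 else 0)"
  shows "independent B"
proof (rule independent_if_scalars_zero[OF assms(2)])
  fix u x assume "(\<Sum>x\<in>B. u x *\<^sub>R x) = 0" "x \<in> B"
  then show "u x = 0"
    using orthonormal_expansion_coeff[OF assms, of x u] bilinear_lzero[OF scalar_product_bilinear[OF assms(1)], of x]
    by simp
qed

text \<open>Gram-Schmidt: an orthonormal set of fewer than \<open>DIM('v)\<close> vectors cannot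
  span, so a vector outside its span, minus its projection and normalised, enlarges it.\<close>

lemma ex_g_orthonormal_basis:
  fixes g :: "'v::euclidean_space \<Rightarrow> 'v \<Rightarrow> real"
  assumes g: "scalar_product g"
  shows "\<exists>B. g_orthonormal_basis g B"
proof -
  have "\<exists>B. finite B \<and> card B = k \<and> (\<forall>x\<in>B. \<forall>y\<in>B. g x y = (if x = y then 1 else 0))"
    if "k \<le> DIM('v)" for k
    using that
  proof (induction k)
    case 0
    show ?case by (rule exI[of _ "{}"]) auto
  next
    case (Suc k)
    then obtain B where B: "finite B" "card B = k"
      "\<And>x y. x \<in> B \<Longrightarrow> y \<in> B \<Longrightarrow> g x y = (if x = y then 1 else 0)"
      by auto
    have "span B \<noteq> UNIV"
    proof
      assume "span B = UNIV"
      then have "DIM('v) \<le> card B" using B(1) by (metis dim_UNIV dim_le_card' dim_span)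
      then show False using B(2) Suc.prems by simp
    qed
    then obtain v where v: "v \<notin> span B" by auto
    define w where "w = v - (\<Sum>x\<in>B. g v x *\<^sub>R x)"
    have "(\<Sum>x\<in>B. g v x *\<^sub>R x) \<in> span B" by (intro span_sum span_scale span_base)
    then have "w \<noteq> 0" using v by (auto simp: w_def)
    then have pos: "g w w > 0" by (rule scalar_product_pos[OF g])
    have orth: "g w y = 0" if "y \<in> B" for y
      using orthonormal_expansion_coeff[OF g B(1,3) that, of "g v"]
      by (simp add: w_def bilinear_simps[OF scalar_product_bilinear[OF g]])
    define e where "e = (1 / sqrt (g w w)) *\<^sub>R w"
    have ey: "g e y = 0" "g y e = 0" if "y \<in> B" for y
      using orth[OF that] scalar_product_sym[OF g, of y w]
      by (simp_all add: e_def bilinear_simps[OF scalar_product_bilinear[OF g]])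
    have ee: "g e e = 1"
      using pos by (simp add: e_def bilinear_simps[OF scalar_product_bilinear[OF g]])
    have "e \<notin> B" using ee ey by force
    then show ?case
      using B ey ee by (intro exI[of _ "insert e B"]) auto
  qed
  from this[of "DIM('v)"] show ?thesis unfolding g_orthonormal_basis_def by blast
qed

lemma linear_inj_imp_bij:
  fixes L :: "'v::euclidean_space \<Rightarrow> 'v"
  assumes "linear L" "\<And>x. L x = 0 \<Longrightarrow> x = 0"
  shows "bij L"
proof -
  have "inj L" using assms by (simp add: linear_injective_0)
  then show ?thesis using assms(1) linear_injective_imp_surjective by (auto simp: bij_def)
qed

lemma similarity_bij:
  fixes L :: "'v::euclidean_space \<Rightarrow> 'v"
  assumes "linear L" "scalar_product g2" "c > 0" "\<And>v w. g1 (L v) (L w) = c * g2 v w" "bilinear g1"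
  shows "bij L"
proof (rule linear_inj_imp_bij[OF assms(1)])
  fix x assume "L x = 0"
  then have "g2 x x = 0" using assms(3) assms(4)[of x x] assms(5) by (simp add: bilinear_simps)
  then show "x = 0" using scalar_product_pos[OF assms(2), of x] by force
qed

text \<open>\<open>T\<close> turns \<open>g\<close> into the standard inner product, to which the
  spectral and metric arguments are reduced; its bijection between bases lets sums over
  \<open>B\<close> be rewritten over \<open>Basis\<close>.\<close>

lemma g_orthonormal_basis_frame:
  fixes g :: "'v::euclidean_space \<Rightarrow> 'v \<Rightarrow> real"
  assumes g: "scalar_product g" and B: "g_orthonormal_basis g B"
  obtains T :: "'v \<Rightarrow> 'v" where "linear T" "bij T" "\<And>v w. g (T v) (T w) = v \<bullet> w" "bij_betw T Basis B"
proof -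
  have fB: "finite B" "card B = DIM('v)" and on: "\<And>x y. x \<in> B \<Longrightarrow> y \<in> B \<Longrightarrow> g x y = (if x = y then 1 else 0)"
    using B by (auto simp: g_orthonormal_basis_def)
  obtain b where b: "bij_betw b (Basis :: 'v set) B"
    using fB finite_same_card_bij[of "Basis :: 'v set" B] by auto
  define T where "T v = (\<Sum>i\<in>Basis. (v \<bullet> i) *\<^sub>R b i)" for v :: 'v
  have lin: "linear T"
    by (rule linearI) (simp_all add: T_def inner_add_left scaleR_add_left sum.distrib scaleR_sum_right)
  have gT: "g (T v) (b j) = v \<bullet> j" if "j \<in> Basis" for v j
  proof -
    \<comment> \<open>Reindexed over \<open>B\<close>, the sum has the form whose coefficients
      \<open>orthonormal_expansion_coeff\<close> reads off.\<close>
    have "T v = (\<Sum>x\<in>B. (v \<bullet> inv_into Basis b x) *\<^sub>R x)"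
      using sum.reindex_bij_betw[OF b, of "\<lambda>x. (v \<bullet> inv_into Basis b x) *\<^sub>R x"] b
      by (simp add: T_def bij_betw_def inv_into_f_f)
    moreover have "b j \<in> B" "inv_into Basis b (b j) = j"
      using that b by (auto simp: bij_betw_def)
    ultimately show ?thesis
      using orthonormal_expansion_coeff[OF g fB(1) on, of "b j" "\<lambda>x. v \<bullet> inv_into Basis b x"]
      by simp
  qed
  have pres: "g (T v) (T w) = v \<bullet> w" for v w
  proof -
    have "g (T v) (T w) = (\<Sum>i\<in>Basis. (w \<bullet> i) * g (T v) (b i))"
      using scalar_product_bilinear[OF g]
      by (simp add: T_def[of w] bilinear_sum_right bilinear_simps)
    also have "\<dots> = v \<bullet> w"
      by (simp add: gT euclidean_inner[of v w] mult.commute)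
    finally show ?thesis .
  qed
  have "T i = b i" if "i \<in> Basis" for i
    using that by (simp add: T_def inner_Basis if_distrib[of "\<lambda>c. c *\<^sub>R _"] cong: if_cong)
  then have "bij_betw T Basis B" using b bij_betw_cong by metis
  moreover have "bij T"
    using similarity_bij[OF lin scalar_product_inner, of 1 g] pres scalar_product_bilinear[OF g] by simp
  ultimately show ?thesis using that lin pres by blast
qed

lemma scalar_product_frame:
  fixes g :: "'v::euclidean_space \<Rightarrow> 'v \<Rightarrow> real"
  assumes "scalar_product g"
  obtains T :: "'v \<Rightarrow> 'v" where "linear T" "bij T" "\<And>v w. g (T v) (T w) = v \<bullet> w"
  using ex_g_orthonormal_basis[OF assms] g_orthonormal_basis_frame[OF assms] by metis

lemma symplectic_form_pullback:
  assumes "symplectic_form \<omega>" "linear T" "bij T"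
  shows "symplectic_form (\<lambda>v w. \<omega> (T v) (T w))"
proof -
  have "v = 0" if "\<And>w. \<omega> (T v) (T w) = 0" for v
  proof -
    have "\<omega> (T v) w = 0" for w
      using that[of "inv T w"] assms(3) by (simp add: bij_is_surj surj_f_inv_f)
    then have "T v = 0" by (rule symplectic_form_nondegenerate[OF assms(1)])
    then show "v = 0"
      using assms(2,3) by (metis bij_is_inj linear_injective_0)
  qed
  moreover have "bilinear (\<lambda>v w. \<omega> (T v) (T w))"
    by (rule bilinear_pullback[OF symplectic_form_bilinear[OF assms(1)] assms(2,2)])
  ultimately show ?thesis
    using symplectic_form_self[OF assms(1)] by (auto simp: symplectic_form_def)
qed

text \<open>Makes \<open>(v, s) \<mapsto> (L v, \<mu> * s)\<close> a group isomorphism, from the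
  second Heisenberg group to the first, that is conformal on \<open>V\<close>. The sign of
  \<open>\<mu>\<close> is free, since the centre may be reversed.\<close>

definition heis_similar :: "('v::euclidean_space \<Rightarrow> 'v \<Rightarrow> real) \<Rightarrow> ('v \<Rightarrow> 'v \<Rightarrow> real) \<Rightarrow>
     ('v \<Rightarrow> 'v \<Rightarrow> real) \<Rightarrow> ('v \<Rightarrow> 'v \<Rightarrow> real) \<Rightarrow> bool" where
  "heis_similar \<omega>1 g1 \<omega>2 g2 \<longleftrightarrow> (\<exists>L \<mu> c. linear L \<and> bij L \<and> \<mu> \<noteq> 0 \<and> c > 0 \<and>
     (\<forall>v w. g1 (L v) (L w) = c * g2 v w) \<and> (\<forall>v w. \<omega>1 (L v) (L w) = \<mu> * \<omega>2 v w))"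

lemma heis_similar_trans:
  assumes "heis_similar \<omega>1 g1 \<omega>2 g2" "heis_similar \<omega>2 g2 \<omega>3 g3"
  shows "heis_similar \<omega>1 g1 \<omega>3 g3"
proof -
  obtain L \<mu> c where 1: "linear L" "bij L" "\<mu> \<noteq> 0" "c > 0" "\<And>v w. g1 (L v) (L w) = c * g2 v w"
    "\<And>v w. \<omega>1 (L v) (L w) = \<mu> * \<omega>2 v w"
    using assms(1) unfolding heis_similar_def by auto
  obtain L' \<mu>' c' where 2: "linear L'" "bij L'" "\<mu>' \<noteq> 0" "c' > 0" "\<And>v w. g2 (L' v) (L' w) = c' * g3 v w"
    "\<And>v w. \<omega>2 (L' v) (L' w) = \<mu>' * \<omega>3 v w"
    using assms(2) unfolding heis_similar_def by auto
  show ?thesis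
    unfolding heis_similar_def
    by (rule exI[of _ "L \<circ> L'"], rule exI[of _ "\<mu> * \<mu>'"], rule exI[of _ "c * c'"])
      (use 1 2 in \<open>simp add: linear_compose bij_comp\<close>)
qed

lemma heis_similar_sym:
  assumes "heis_similar \<omega>1 g1 \<omega>2 g2"
  shows "heis_similar \<omega>2 g2 \<omega>1 g1"
proof -
  obtain L \<mu> c where 1: "linear L" "bij L" "\<mu> \<noteq> 0" "c > 0" "\<And>v w. g1 (L v) (L w) = c * g2 v w"
    "\<And>v w. \<omega>1 (L v) (L w) = \<mu> * \<omega>2 v w"
    using assms(1) unfolding heis_similar_def by auto
  have LI: "L (inv L x) = x" for x using 1(2) by (simp add: bij_is_surj surj_f_inv_f)
  have "inv L (L x) = x" for x using 1(2) by (simp add: bij_is_inj)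
  then have lin: "linear (inv L)"
    by (intro linearI) (metis LI linear_add[OF 1(1)], metis LI linear_cmul[OF 1(1)])
  have inv': "g2 (inv L v) (inv L w) = 1 / c * g1 v w" "\<omega>2 (inv L v) (inv L w) = 1 / \<mu> * \<omega>1 v w" for v w
    using 1(3,4) 1(5,6)[of "inv L v" "inv L w"] by (simp_all add: LI)
  show ?thesis
    unfolding heis_similar_def
    by (rule exI[of _ "inv L"], rule exI[of _ "1 / \<mu>"], rule exI[of _ "1 / c"])
      (use 1(3,4) inv' lin bij_imp_bij_inv[OF 1(2)] in simp)
qed

lemma heis_similar_pullback:
  assumes "linear T" "bij T" "\<And>v w. g (T v) (T w) = v \<bullet> w"
  shows "heis_similar \<omega> g (\<lambda>v w. \<omega> (T v) (T w)) (\<bullet>)"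
  unfolding heis_similar_def
  by (rule exI[of _ T], rule exI[of _ 1], rule exI[of _ 1]) (use assms in simp)

section \<open>The operator of a form and the scaling of its spectrum\<close>

lemma A_op_eqI:
  assumes g: "scalar_product g" and "linear A" "\<And>v w. \<omega> v w = g v (A w)"
  shows "A_op \<omega> g = A"
  unfolding A_op_def
proof (rule the_equality)
  fix A' assume A': "linear A' \<and> (\<forall>v w. \<omega> v w = g v (A' w))"
  show "A' = A"
  proof
    fix w
    have "g (A' w - A w) (A' w - A w) = 0"
      using A' assms(3) by (simp add: bilinear_rsub[OF scalar_product_bilinear[OF g]])
    then show "A' w = A w" using scalar_product_pos[OF g, of "A' w - A w"] by force
  qed
qed (use assms in auto)

lemma A_op_works:
  fixes g :: "'v::euclidean_space \<Rightarrow> 'v \<Rightarrow> real"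
  assumes g: "scalar_product g" and \<omega>: "bilinear \<omega>"
  shows "linear (A_op \<omega> g)" "\<omega> v w = g v (A_op \<omega> g w)"
proof -
  obtain T :: "'v \<Rightarrow> 'v" where T: "linear T" "bij T" "\<And>v w. g (T v) (T w) = v \<bullet> w"
    using scalar_product_frame[OF g] by metis
  \<comment> \<open>Riesz representation in the \<open>g\<close>-orthonormal basis of the
    \<open>T b\<close>: the coefficient of \<open>A w\<close> at \<open>T b\<close> has to be
    \<open>g (T b) (A w) = \<omega> (T b) w\<close>.\<close>
  define A where "A w = (\<Sum>b\<in>Basis. \<omega> (T b) w *\<^sub>R T b)" for w
  have lin: "linear A"
    by (rule linearI) (simp_all add: A_def bilinear_simps[OF \<omega>] scaleR_add_left sum.distrib scaleR_sum_right)
  have "\<omega> v w = g v (A w)" for v w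
  proof -
    obtain x where x: "v = T x" using T(2) by (metis bij_pointE)
    have "\<omega> v w = \<omega> (T (\<Sum>b\<in>Basis. (x \<bullet> b) *\<^sub>R b)) w" by (simp add: x euclidean_representation)
    also have "\<dots> = (\<Sum>b\<in>Basis. (x \<bullet> b) * \<omega> (T b) w)"
      by (simp add: linear_sum[OF T(1)] linear_cmul[OF T(1)] bilinear_sum_left[OF \<omega>] bilinear_simps[OF \<omega>])
    also have "\<dots> = g v (A w)"
      using scalar_product_bilinear[OF g]
      by (simp add: A_def bilinear_sum_right bilinear_simps T(3) x mult.commute)
    finally show ?thesis .
  qed
  then have "A_op \<omega> g = A" by (intro A_op_eqI g lin)
  then show "linear (A_op \<omega> g)" "\<omega> v w = g v (A_op \<omega> g w)"
    using lin \<open>\<And>w v. \<omega> v w = g v (A w)\<close> by auto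
qed

text \<open>\<open>L\<close> intertwines the two operators up to \<open>\<mu> / c\<close>: testing
  against \<open>L v\<close>, the form contributes \<open>\<mu>\<close> and the scalar product takes
  away \<open>c\<close>. Hence \<open>L\<close> maps eigenspaces of the squares onto each other,
  with eigenvalues rescaled by the square of that factor.\<close>

lemma eig_mult_similar:
  assumes g1: "scalar_product g1" and g2: "scalar_product g2" and \<omega>1: "bilinear \<omega>1" and \<omega>2: "bilinear \<omega>2"
    and L: "linear L" "bij L" "\<mu> \<noteq> 0" "c > 0"
    and Lg: "\<And>v w. g1 (L v) (L w) = c * g2 v w" and L\<omega>: "\<And>v w. \<omega>1 (L v) (L w) = \<mu> * \<omega>2 v w"
  shows "eig_mult \<omega>1 g1 ((\<mu> / c)\<^sup>2 * \<kappa>) = eig_mult \<omega>2 g2 \<kappa>"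
proof -
  let ?A1 = "A_op \<omega>1 g1" and ?A2 = "A_op \<omega>2 g2"
  note A1 = A_op_works[OF g1 \<omega>1] and A2 = A_op_works[OF g2 \<omega>2]
  have AL: "?A1 (L x) = (\<mu> / c) *\<^sub>R L (?A2 x)" for x
  proof -
    define d where "d = ?A1 (L x) - (\<mu> / c) *\<^sub>R L (?A2 x)"
    have "g1 (L v) d = 0" for v
      using L\<omega>[of v x] A1(2)[of "L v" "L x"] A2(2)[of v x] Lg[of v "?A2 x"] L(4)
      by (simp add: d_def bilinear_simps[OF scalar_product_bilinear[OF g1]])
    moreover obtain v where "d = L v" using L(2) by (metis bij_pointE)
    ultimately have "g1 d d = 0" by simp
    then show ?thesis using scalar_product_pos[OF g1, of d] by (force simp: d_def)
  qed
  have "?A1 (?A1 (L x)) = (\<mu> / c)\<^sup>2 *\<^sub>R L (?A2 (?A2 x))" for x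
    by (simp add: AL linear_cmul[OF A1(1)] power2_eq_square)
  moreover have "(\<mu> / c)\<^sup>2 \<noteq> 0" using L by simp
  ultimately have "?A1 (?A1 (L x)) = ((\<mu> / c)\<^sup>2 * \<kappa>) *\<^sub>R L x \<longleftrightarrow> L (?A2 (?A2 x)) = L (\<kappa> *\<^sub>R x)" for x
    by (simp only: linear_cmul[OF L(1), of \<kappa> x] scaleR_cancel_left flip: scaleR_scaleR) auto
  then have iff: "?A1 (?A1 (L x)) = ((\<mu> / c)\<^sup>2 * \<kappa>) *\<^sub>R L x \<longleftrightarrow> ?A2 (?A2 x) = \<kappa> *\<^sub>R x" for x
    using bij_is_inj[OF L(2)] by (simp only: inj_eq)
  have "{x. ?A1 (?A1 x) = ((\<mu> / c)\<^sup>2 * \<kappa>) *\<^sub>R x} = L ` {x. ?A2 (?A2 x) = \<kappa> *\<^sub>R x}"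
  proof (intro set_eqI iffI)
    fix y assume y: "y \<in> {x. ?A1 (?A1 x) = ((\<mu> / c)\<^sup>2 * \<kappa>) *\<^sub>R x}"
    obtain x where "y = L x" using L(2) by (metis bij_pointE)
    then show "y \<in> L ` {x. ?A2 (?A2 x) = \<kappa> *\<^sub>R x}" using y iff by blast
  qed (use iff in blast)
  moreover have "inj_on L (span {x. ?A2 (?A2 x) = \<kappa> *\<^sub>R x})"
    using bij_is_inj[OF L(2)] inj_on_subset by blast
  ultimately show ?thesis
    unfolding eig_mult_def using dim_image_eq[OF L(1)] by metis
qed

lemma sorted_list_of_multiset_image_mono:
  assumes "mono f"
  shows "sorted_list_of_multiset (image_mset f M) = map f (sorted_list_of_multiset M)"
proof -
  have "sorted (map f (sorted_list_of_multiset M))"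
    using sorted_wrt_mono_rel[of "sorted_list_of_multiset M" "(\<le>)" "\<lambda>x y. f x \<le> f y"] monoD[OF assms]
    by (simp add: sorted_map)
  moreover have "mset (map f (sorted_list_of_multiset M)) = image_mset f M" by simp
  ultimately show ?thesis by (metis sorted_list_of_multiset_mset sorted_sort_id)
qed

lemma image_mset_sum: "image_mset f (sum h A) = (\<Sum>x\<in>A. image_mset f (h x))"
  by (induction A rule: infinite_finite_induct) auto

lemma sympl_spec_similar:
  assumes g1: "scalar_product g1" and g2: "scalar_product g2" and \<omega>1: "bilinear \<omega>1" and \<omega>2: "bilinear \<omega>2"
    and "heis_similar \<omega>1 g1 \<omega>2 g2"
  shows "\<exists>\<rho>>0. sympl_spec \<omega>1 g1 = map (\<lambda>r. \<rho> * r) (sympl_spec \<omega>2 g2)"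
proof -
  obtain L \<mu> c where L: "linear L" "bij L" "\<mu> \<noteq> 0" "c > 0" "\<And>v w. g1 (L v) (L w) = c * g2 v w"
    "\<And>v w. \<omega>1 (L v) (L w) = \<mu> * \<omega>2 v w"
    using assms(5) unfolding heis_similar_def by auto
  \<comment> \<open>Eigenvalues \<open>- (r ^ 4)\<close> scale by
    \<open>(\<mu> / c)\<^sup>2\<close>, so the numbers \<open>r\<close> scale by its positive fourth
    root.\<close>
  define \<rho> where "\<rho> = sqrt \<bar>\<mu> / c\<bar>"
  have \<rho>: "\<rho> > 0" using L by (simp add: \<rho>_def)
  have "\<rho> ^ 4 = (\<mu> / c)\<^sup>2"
  proof -
    have "\<rho> ^ 4 = (\<rho>\<^sup>2)\<^sup>2" by simp
    also have "\<dots> = (\<mu> / c)\<^sup>2" unfolding \<rho>_def by (subst real_sqrt_pow2) (simp_all del: abs_divide)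
    finally show ?thesis .
  qed
  then have mult: "eig_mult \<omega>1 g1 (- ((\<rho> * r) ^ 4)) = eig_mult \<omega>2 g2 (- (r ^ 4))" for r
    using eig_mult_similar[OF g1 g2 \<omega>1 \<omega>2 L, of "- (r ^ 4)"] by (simp add: power_mult_distrib)
  let ?R1 = "{r. r > 0 \<and> eig_mult \<omega>1 g1 (- (r ^ 4)) \<noteq> 0}" and ?R2 = "{r. r > 0 \<and> eig_mult \<omega>2 g2 (- (r ^ 4)) \<noteq> 0}"
  have R1: "?R1 = (\<lambda>r. \<rho> * r) ` ?R2"
  proof (intro set_eqI iffI)
    fix r assume "r \<in> ?R1"
    then show "r \<in> (\<lambda>r. \<rho> * r) ` ?R2"
      using \<rho> mult[of "r / \<rho>"] by (intro image_eqI[of _ _ "r / \<rho>"]) auto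
  qed (use \<rho> mult in \<open>auto simp: zero_less_mult_iff\<close>)
  have "inj_on (\<lambda>r. \<rho> * r) ?R2" using \<rho> by (simp add: inj_on_def)
  then have "sympl_spec_mset \<omega>1 g1 = image_mset (\<lambda>r. \<rho> * r) (sympl_spec_mset \<omega>2 g2)"
    unfolding sympl_spec_mset_def R1
    by (simp add: sum.reindex mult o_def image_mset_sum)
  moreover have "mono (\<lambda>r. \<rho> * r)" using \<rho> by (simp add: mono_def)
  ultimately show ?thesis
    using \<rho> by (auto simp: sympl_spec_def sorted_list_of_multiset_image_mono)
qed

section \<open>Normal form of skew maps: orthogonal invariant planes carrying scaled quarter
  turns\<close>

definition skew_frame :: "('v::euclidean_space \<Rightarrow> 'v) \<Rightarrow> 'v set \<Rightarrow> nat \<Rightarrow> (nat \<Rightarrow> 'v) \<Rightarrow> (nat \<Rightarrow> 'v) \<Rightarrow> (nat \<Rightarrow> real) \<Rightarrow> bool" where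
  "skew_frame A S n e f a \<longleftrightarrow>
     (\<forall>i<n. e i \<in> S \<and> f i \<in> S \<and> a i > 0 \<and> A (e i) = a i *\<^sub>R f i \<and> A (f i) = - (a i *\<^sub>R e i)) \<and>
     (\<forall>i<n. \<forall>j<n. e i \<bullet> e j = (if i = j then 1 else 0) \<and> f i \<bullet> f j = (if i = j then 1 else 0) \<and> e i \<bullet> f j = 0) \<and>
     (\<forall>x\<in>S. x = (\<Sum>i<n. (x \<bullet> e i) *\<^sub>R e i + (x \<bullet> f i) *\<^sub>R f i))"

text \<open>The eigenvector of the symmetric map \<open>A \<circ> A\<close> is found by maximising
  \<open>norm (A v)\<close> over the unit sphere of \<open>S\<close>; the square of the maximum is
  the eigenvalue up to sign.\<close>

lemma skew_maximal_eigenvector: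
  fixes A :: "'v::euclidean_space \<Rightarrow> 'v"
  assumes A: "linear A" and skew: "\<And>v w. A v \<bullet> w = - (v \<bullet> A w)"
    and S: "subspace S" "A ` S \<subseteq> S" "S \<noteq> {0}"
  obtains e where "e \<in> S" "norm e = 1" "A (A e) = - ((norm (A e))\<^sup>2 *\<^sub>R e)"
proof -
  let ?K = "sphere 0 1 \<inter> S"
  obtain x where x: "x \<in> S" "x \<noteq> 0" using S subspace_0 by blast
  then have "(1 / norm x) *\<^sub>R x \<in> ?K" using S(1) by (simp add: subspace_scale)
  then have "?K \<noteq> {}" by blast
  moreover have "compact ?K" using S(1) by (simp add: closed_subspace compact_Int_closed)
  moreover have "continuous_on ?K (\<lambda>v. norm (A v))"
    using A by (intro continuous_intros linear_continuous_on linear_linear[THEN iffD2]) (simp add: linear_conv_bounded_linear)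
  ultimately obtain e where e: "e \<in> ?K" "\<And>v. v \<in> ?K \<Longrightarrow> norm (A v) \<le> norm (A e)"
    using continuous_attains_sup[of ?K "\<lambda>v. norm (A v)"] by blast
  define c where "c = (norm (A e))\<^sup>2"
  have bound: "A v \<bullet> A v \<le> c * (v \<bullet> v)" if "v \<in> S" for v
  proof (cases "v = 0")
    case False
    then have "(1 / norm v) *\<^sub>R v \<in> ?K" using S(1) that by (simp add: subspace_scale)
    from e(2)[OF this] have "norm (A v) \<le> norm (A e) * norm v"
      using False by (simp add: linear_cmul[OF A] divide_simps)
    then have "(norm (A v))\<^sup>2 \<le> (norm (A e) * norm v)\<^sup>2" by (intro power_mono) auto
    then show ?thesis by (simp add: c_def power_mult_distrib power2_norm_eq_inner)
  qed (simp add: linear_0[OF A])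
  have ee: "e \<bullet> e = 1" using e(1) by (simp add: norm_eq_sqrt_inner)
  \<comment> \<open>\<open>w\<close> is the failure of the eigenvalue equation. Moving
    \<open>e\<close> in the direction \<open>w\<close> makes \<open>w \<bullet> w\<close> the
    first-order coefficient of the form below, and this coefficient must vanish.\<close>
  define w where "w = A (A e) + c *\<^sub>R e"
  have eS: "e \<in> S" using e by simp
  have wS: "w \<in> S" unfolding w_def using S eS by (intro subspace_add subspace_scale) auto
  define \<beta> where "\<beta> = c * (e \<bullet> w) - A e \<bullet> A w"
  define \<gamma> where "\<gamma> = c * (w \<bullet> w) - A w \<bullet> A w"
  \<comment> \<open>The form \<open>c v \<bullet> v - A v \<bullet> A v\<close> is positive semidefinite on \<open>S\<close> and vanishes at \<open>e\<close>.\<close>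
  have q: "2 * t * \<beta> + t\<^sup>2 * \<gamma> \<ge> 0" for t
  proof -
    have "e + t *\<^sub>R w \<in> S" using S(1) eS wS by (intro subspace_add subspace_scale)
    moreover have "A e \<bullet> A e = c" by (simp add: c_def power2_norm_eq_inner)
    ultimately show ?thesis
      using bound[of "e + t *\<^sub>R w"]
      by (simp add: linear_add[OF A] linear_cmul[OF A] inner_add_left inner_add_right \<beta>_def \<gamma>_def ee
          inner_commute algebra_simps power2_eq_square)
  qed
  have "\<beta> = 0"
  proof (rule ccontr)
    assume "\<beta> \<noteq> 0"
    define k where "k = \<bar>\<gamma>\<bar> + 1"
    \<comment> \<open>The minimiser of \<open>2 * t * \<beta> + t\<^sup>2 * k\<close>, where
      \<open>k\<close> is a positive bound for \<open>\<gamma>\<close>.\<close>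
    define t where "t = - \<beta> / k"
    have k: "k > 0" by (simp add: k_def)
    have "2 * t * \<beta> + t\<^sup>2 * \<gamma> \<le> 2 * t * \<beta> + t\<^sup>2 * k"
      unfolding k_def by (intro add_left_mono mult_left_mono) auto
    also have "\<dots> = - \<beta>\<^sup>2 / k"
      using k by (simp add: t_def power2_eq_square field_simps)
    also have "\<dots> < 0" using \<open>\<beta> \<noteq> 0\<close> k by (simp add: divide_neg_pos)
    finally show False using q[of t] by simp
  qed
  moreover have "\<beta> = w \<bullet> w"
    using skew[of "A e" w] by (simp add: \<beta>_def w_def inner_add_left inner_commute)
  ultimately have "w = 0" by simp
  then have "A (A e) = - ((norm (A e))\<^sup>2 *\<^sub>R e)" by (simp add: w_def c_def eq_neg_iff_add_eq_0)
  then show ?thesis using that e eS by simp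
qed

text \<open>Each step splits off the plane of an eigenvector \<open>e0\<close> of
  \<open>A \<circ> A\<close> and its normalised image \<open>f0\<close>. Skewness makes the
  orthogonal complement of that plane in \<open>S\<close> invariant again, and injectivity keeps the
  factor \<open>a0\<close> positive. Allowing invariant subspaces \<open>S\<close> makes the
  induction on dimension possible.\<close>

lemma ex_skew_frame:
  fixes A :: "'v::euclidean_space \<Rightarrow> 'v"
  assumes A: "linear A" and skew: "\<And>v w. A v \<bullet> w = - (v \<bullet> A w)" and inj: "\<And>v. A v = 0 \<Longrightarrow> v = 0"
    and "subspace S" "A ` S \<subseteq> S"
  shows "\<exists>n e f a. skew_frame A S n e f a"
  using assms(4,5)
proof (induction "dim S" arbitrary: S rule: less_induct)
  case less
  show ?case
  proof (cases "S = {0}")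
    case True
    then show ?thesis by (intro exI[of _ 0] exI[of _ "\<lambda>_. 0"]) (simp add: skew_frame_def)
  next
    case False
    obtain e0 where e0: "e0 \<in> S" "norm e0 = 1" "A (A e0) = - ((norm (A e0))\<^sup>2 *\<^sub>R e0)"
      using skew_maximal_eigenvector[OF A skew less.prems False] by blast
    define a0 where "a0 = norm (A e0)"
    define f0 where "f0 = (1 / a0) *\<^sub>R A e0"
    have a0: "a0 > 0" using inj[of e0] e0(2) by (auto simp: a0_def)
    have Ae0: "A e0 = a0 *\<^sub>R f0" using a0 by (simp add: f0_def)
    have Af0: "A f0 = - (a0 *\<^sub>R e0)"
      using a0 e0(3) by (simp add: f0_def linear_cmul[OF A] a0_def[symmetric] power2_eq_square)
    have f0S: "f0 \<in> S" using less.prems e0(1) by (auto simp: f0_def intro: subspace_scale)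
    have e0e0: "e0 \<bullet> e0 = 1" using e0(2) by (simp add: norm_eq_sqrt_inner)
    have f0f0: "f0 \<bullet> f0 = 1" using a0 by (simp add: f0_def a0_def power2_norm_eq_inner[symmetric] power2_eq_square)
    have e0f0: "e0 \<bullet> f0 = 0" using skew[of e0 e0] by (simp add: f0_def inner_commute)
    define S' where "S' = {x \<in> S. x \<bullet> e0 = 0 \<and> x \<bullet> f0 = 0}"
    have S': "subspace S'" using less.prems(1) unfolding S'_def subspace_def by (auto simp: inner_add_left)
    have AS': "A ` S' \<subseteq> S'"
      using less.prems(2) by (auto simp: S'_def skew Ae0 Af0)
    have "e0 \<notin> S'" using e0e0 by (simp add: S'_def)
    moreover have "S' \<subseteq> S" by (auto simp: S'_def)
    ultimately have "S' \<subset> S" using e0(1) by blast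
    then have "dim S' < dim S"
      using S' less.prems(1) by (metis dim_psubset span_eq_iff)
    from less.hyps[OF this S' AS'] obtain n e f a where fr: "skew_frame A S' n e f a" by blast
    have in': "e i \<in> S'" "f i \<in> S'" if "i < n" for i using fr that by (auto simp: skew_frame_def)
    then have orth: "e i \<bullet> e0 = 0" "e i \<bullet> f0 = 0" "f i \<bullet> e0 = 0" "f i \<bullet> f0 = 0"
      "e0 \<bullet> e i = 0" "f0 \<bullet> e i = 0" "e0 \<bullet> f i = 0" "f0 \<bullet> f i = 0" "e i \<in> S" "f i \<in> S" if "i < n" for i
      using that by (auto simp: S'_def inner_commute)
    \<comment> \<open>The new plane gets index 0; the old ones are shifted by one.\<close>
    define e' f' a' where "e' = case_nat e0 e" and "f' = case_nat f0 f" and "a' = case_nat a0 a"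
    have "x = (\<Sum>i<Suc n. (x \<bullet> e' i) *\<^sub>R e' i + (x \<bullet> f' i) *\<^sub>R f' i)" if "x \<in> S" for x
    proof -
      define y where "y = x - (x \<bullet> e0) *\<^sub>R e0 - (x \<bullet> f0) *\<^sub>R f0"
      have "y \<in> S'" using that e0(1) f0S less.prems(1) e0e0 f0f0 e0f0 inner_commute[of f0 e0]
        by (auto simp: y_def S'_def inner_diff_left subspace_diff subspace_scale)
      then have "y = (\<Sum>i<n. (y \<bullet> e i) *\<^sub>R e i + (y \<bullet> f i) *\<^sub>R f i)"
        using fr unfolding skew_frame_def by blast
      also have "\<dots> = (\<Sum>i<n. (x \<bullet> e i) *\<^sub>R e i + (x \<bullet> f i) *\<^sub>R f i)"
        by (rule sum.cong) (auto simp: y_def inner_diff_left orth)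
      finally show ?thesis
        by (simp add: sum.lessThan_Suc_shift e'_def f'_def y_def algebra_simps del: sum.lessThan_Suc)
    qed
    moreover have "e' i \<in> S \<and> f' i \<in> S \<and> a' i > 0 \<and> A (e' i) = a' i *\<^sub>R f' i \<and> A (f' i) = - (a' i *\<^sub>R e' i)"
      if "i < Suc n" for i
      using that fr orth e0(1) f0S a0 Ae0 Af0
      by (cases i) (auto simp: e'_def f'_def a'_def skew_frame_def)
    moreover have "e' i \<bullet> e' j = (if i = j then 1 else 0) \<and> f' i \<bullet> f' j = (if i = j then 1 else 0) \<and> e' i \<bullet> f' j = 0"
      if "i < Suc n" "j < Suc n" for i j
      using that fr orth e0e0 f0f0 e0f0
      by (cases i; cases j) (auto simp: e'_def f'_def skew_frame_def)
    ultimately have "skew_frame A S (Suc n) e' f' a'" unfolding skew_frame_def by blast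
    then show ?thesis by blast
  qed
qed


lemma skew_frame_inner:
  assumes "skew_frame A UNIV n e f a"
  shows "x \<bullet> y = (\<Sum>i<n. (x \<bullet> e i) * (y \<bullet> e i) + (x \<bullet> f i) * (y \<bullet> f i))"
proof -
  have "x = (\<Sum>i<n. (x \<bullet> e i) *\<^sub>R e i + (x \<bullet> f i) *\<^sub>R f i)"
    using assms by (simp add: skew_frame_def)
  then have "x \<bullet> y = (\<Sum>i<n. (x \<bullet> e i) *\<^sub>R e i + (x \<bullet> f i) *\<^sub>R f i) \<bullet> y" by simp
  also have "\<dots> = (\<Sum>i<n. (x \<bullet> e i) * (y \<bullet> e i) + (x \<bullet> f i) * (y \<bullet> f i))"
    by (simp only: inner_sum_left inner_add_left inner_scaleR_left inner_commute[of y])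
  finally show ?thesis .
qed

text \<open>The frame diagonalises \<open>A \<circ> A\<close>, each index contributing two vectors
  with eigenvalue \<open>- ((a i)\<^sup>2)\<close>; the resulting factor 2 is the one halved in the
  symplectic spectrum.\<close>

lemma skew_frame_eigenspace_dim:
  fixes A :: "'v::euclidean_space \<Rightarrow> 'v"
  assumes A: "linear A" and skew: "\<And>v w. A v \<bullet> w = - (v \<bullet> A w)" and fr: "skew_frame A UNIV n e f a"
  shows "dim {x. A (A x) = - c *\<^sub>R x} = 2 * card {i. i < n \<and> (a i)\<^sup>2 = c}"
proof -
  define I where "I = {i. i < n \<and> (a i)\<^sup>2 = c}"
  define E where "E = {x. A (A x) = - c *\<^sub>R x}"
  have I: "finite I" "\<And>i. i \<in> I \<Longrightarrow> i < n" by (auto simp: I_def)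
  have A2: "A (A (e i)) = - ((a i)\<^sup>2 *\<^sub>R e i)" "A (A (f i)) = - ((a i)\<^sup>2 *\<^sub>R f i)" if "i < n" for i
    using fr that by (auto simp: skew_frame_def linear_cmul[OF A] linear_neg[OF A] power2_eq_square)
  have on: "e i \<bullet> e j = (if i = j then 1 else 0)" "f i \<bullet> f j = (if i = j then 1 else 0)" "e i \<bullet> f j = 0" "f j \<bullet> e i = 0"
    if "i < n" "j < n" for i j
    using fr that by (auto simp: skew_frame_def inner_commute)
  have "subspace E"
    by (auto simp: E_def subspace_def linear_0[OF A] linear_add[OF A] linear_cmul[OF A] algebra_simps)
  moreover have "e ` I \<union> f ` I \<subseteq> E" using A2 by (auto simp: E_def I_def)
  ultimately have 1: "span (e ` I \<union> f ` I) \<subseteq> E" by (simp add: span_minimal)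
  have 2: "E \<subseteq> span (e ` I \<union> f ` I)"
  proof
    fix x assume x: "x \<in> E"
    \<comment> \<open>\<open>A \<circ> A\<close> is symmetric, so an eigenvector for
      \<open>- c\<close> is orthogonal to the frame vectors with another eigenvalue.\<close>
    have zero: "x \<bullet> e i = 0 \<and> x \<bullet> f i = 0" if "i < n" "i \<notin> I" for i
    proof -
      have "A (A x) \<bullet> y = x \<bullet> A (A y)" for y by (simp add: skew)
      then have "- c * (x \<bullet> y) = x \<bullet> A (A y)" for y using x by (simp add: E_def)
      from this[of "e i"] this[of "f i"] show ?thesis using A2[OF that(1)] that by (simp add: I_def)
    qed
    have "x = (\<Sum>i<n. (x \<bullet> e i) *\<^sub>R e i + (x \<bullet> f i) *\<^sub>R f i)"
      using fr by (simp add: skew_frame_def)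
    also have "\<dots> = (\<Sum>i\<in>I. (x \<bullet> e i) *\<^sub>R e i + (x \<bullet> f i) *\<^sub>R f i)"
      using zero I by (intro sum.mono_neutral_right) auto
    also have "\<dots> \<in> span (e ` I \<union> f ` I)"
      by (intro span_sum span_add span_scale span_base) auto
    finally show "x \<in> span (e ` I \<union> f ` I)" .
  qed
  have ne: "e i \<noteq> f j" if "i < n" "j < n" for i j using on[OF that] on[of i i] that by force
  have inj: "inj_on e I" "inj_on f I"
    using on I by (auto simp: inj_on_def) (metis zero_neq_one)+
  have "e ` I \<inter> f ` I = {}" using ne I by blast
  then have "card (e ` I \<union> f ` I) = 2 * card I"
    using I(1) inj by (simp add: card_Un_disjoint card_image)
  moreover have "independent (e ` I \<union> f ` I)"
  proof (rule orthonormal_independent[OF scalar_product_inner])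
    fix x y assume "x \<in> e ` I \<union> f ` I" "y \<in> e ` I \<union> f ` I"
    then show "x \<bullet> y = (if x = y then 1 else 0)" using I on ne by auto
  qed (use I in auto)
  ultimately have "dim E = 2 * card I"
    using 1 2 by (metis dim_span_eq_card_independent subset_antisym)
  then show ?thesis by (simp add: E_def I_def)
qed

text \<open>For positive \<open>r\<close>, the eigenvalue \<open>- (r ^ 4)\<close> is the one of the
  \<open>i\<close>-th plane, \<open>- ((a i)\<^sup>2)\<close>, exactly when
  \<open>r = sqrt (a i)\<close>.\<close>

lemma sympl_spec_mset_skew_frame:
  fixes A :: "'v::euclidean_space \<Rightarrow> 'v"
  assumes A: "linear A" and skew: "\<And>v w. A v \<bullet> w = - (v \<bullet> A w)" and fr: "skew_frame A UNIV n e f a"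
    and A_op: "A_op \<omega> (\<bullet>) = A"
  shows "sympl_spec_mset \<omega> (\<bullet>) = image_mset (\<lambda>i. sqrt (a i)) (mset_set {..<n})"
proof -
  have apos: "a i > 0" if "i < n" for i using fr that by (simp add: skew_frame_def)
  have "{i. i < n \<and> (a i)\<^sup>2 = r ^ 4} = {i \<in> {..<n}. sqrt (a i) = r}" if "r > 0" for r
  proof -
    have "(a i)\<^sup>2 = r ^ 4 \<longleftrightarrow> sqrt (a i) = r" if "i < n" for i
    proof -
      have "(a i)\<^sup>2 = r ^ 4 \<longleftrightarrow> (a i)\<^sup>2 = (r\<^sup>2)\<^sup>2" by simp
      also have "\<dots> \<longleftrightarrow> a i = r\<^sup>2" using apos[OF that] by (subst power2_eq_iff_nonneg) auto
      also have "\<dots> \<longleftrightarrow> sqrt (a i) = r"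
        using apos[OF that] \<open>r > 0\<close> real_sqrt_unique[of r "a i"] by auto
      finally show ?thesis .
    qed
    then show ?thesis by auto
  qed
  then have mult: "eig_mult \<omega> (\<bullet>) (- (r ^ 4)) = 2 * card {i \<in> {..<n}. sqrt (a i) = r}" if "r > 0" for r
    using skew_frame_eigenspace_dim[OF A skew fr, of "r ^ 4"] that by (simp add: eig_mult_def A_op)
  let ?R = "{r. r > 0 \<and> eig_mult \<omega> (\<bullet>) (- (r ^ 4)) \<noteq> 0}"
  \<comment> \<open>As an image of a finite set, the index set in the spectrum is finite; over an
    infinite one the sum would take its default value 0.\<close>
  have R: "?R = (\<lambda>i. sqrt (a i)) ` {..<n}"
    using apos mult by (auto simp: card_gt_0_iff)
  show ?thesis
  proof (rule multiset_eqI)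
    fix x
    have "count (sympl_spec_mset \<omega> (\<bullet>)) x = (\<Sum>r\<in>?R. if x = r then eig_mult \<omega> (\<bullet>) (- (r ^ 4)) div 2 else 0)"
      unfolding sympl_spec_mset_def by (simp add: count_sum)
    also have "\<dots> = (if x \<in> ?R then card {i \<in> {..<n}. sqrt (a i) = x} else 0)"
    proof -
      have "finite ?R" unfolding R by simp
      then show ?thesis by (subst sum.delta') (use mult[of x] in auto)
    qed
    also have "\<dots> = card {i \<in> {..<n}. sqrt (a i) = x}"
      unfolding R by (auto simp: card_eq_0_iff)
    also have "\<dots> = count (image_mset (\<lambda>i. sqrt (a i)) (mset_set {..<n})) x"
      by (simp add: count_image_mset_eq_card_vimage)
    finally show "count (sympl_spec_mset \<omega> (\<bullet>)) x = count (image_mset (\<lambda>i. sqrt (a i)) (mset_set {..<n})) x" .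
  qed
qed

lemma symplectic_form_op:
  fixes \<omega> :: "'v::euclidean_space \<Rightarrow> 'v \<Rightarrow> real"
  assumes \<omega>: "symplectic_form \<omega>"
  defines "A \<equiv> A_op \<omega> (\<bullet>)"
  shows "linear A" "\<omega> v w = v \<bullet> A w" "A v \<bullet> w = - (v \<bullet> A w)" "A v = 0 \<Longrightarrow> v = 0"
proof -
  note works = A_op_works[OF scalar_product_inner symplectic_form_bilinear[OF \<omega>], folded A_def]
  show "linear A" "\<omega> v w = v \<bullet> A w" by (rule works)+
  show "A v \<bullet> w = - (v \<bullet> A w)"
    using symplectic_form_skew[OF \<omega>, of v w] works(2)[of v w] works(2)[of w v] by (simp add: inner_commute)
  show "v = 0" if "A v = 0"
  proof (rule symplectic_form_nondegenerate[OF \<omega>])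
    show "\<omega> v w = 0" for w
      using symplectic_form_skew[OF \<omega>, of v w] works(2)[of w v] that by simp
  qed
qed

lemma symplectic_skew_frame:
  fixes \<omega> :: "'v::euclidean_space \<Rightarrow> 'v \<Rightarrow> real"
  assumes \<omega>: "symplectic_form \<omega>"
  shows "\<exists>n e f a. skew_frame (A_op \<omega> (\<bullet>)) UNIV n e f a \<and>
    sympl_spec_mset \<omega> (\<bullet>) = image_mset (\<lambda>i. sqrt (a i)) (mset_set {..<n})"
proof -
  note op = symplectic_form_op[OF \<omega>]
  obtain n e f a where fr: "skew_frame (A_op \<omega> (\<bullet>)) UNIV n e f a"
    using ex_skew_frame[OF op(1,3,4), of UNIV] by auto
  then show ?thesis
    using sympl_spec_mset_skew_frame[OF op(1,3) fr refl] by blast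
qed

text \<open>Equality of the multisets matches the invariant planes of the two forms by a
  permutation. Sending each plane of \<open>\<omega>2\<close> to its partner, \<open>e2 i\<close> to
  \<open>e1 i\<close> and \<open>f2 i\<close> to \<open>f1 i\<close>, gives an orthogonal map that
  multiplies the form by \<open>\<rho>\<^sup>2\<close>.\<close>

lemma heis_similar_of_spec_inner:
  fixes \<omega>1 \<omega>2 :: "'v::euclidean_space \<Rightarrow> 'v \<Rightarrow> real"
  assumes \<omega>1: "symplectic_form \<omega>1" and \<omega>2: "symplectic_form \<omega>2" and "\<rho> > 0"
    and spec: "sympl_spec_mset \<omega>1 (\<bullet>) = image_mset (\<lambda>r. \<rho> * r) (sympl_spec_mset \<omega>2 (\<bullet>))"
  shows "heis_similar \<omega>1 (\<bullet>) \<omega>2 (\<bullet>)"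
proof -
  define A1 A2 where "A1 = A_op \<omega>1 (\<bullet>)" and "A2 = A_op \<omega>2 (\<bullet>)"
  note 1 = symplectic_form_op[OF \<omega>1, folded A1_def] and 2 = symplectic_form_op[OF \<omega>2, folded A2_def]
  obtain n e1 f1 a1 where fr1: "skew_frame A1 UNIV n e1 f1 a1"
    and s1: "sympl_spec_mset \<omega>1 (\<bullet>) = image_mset (\<lambda>i. sqrt (a1 i)) (mset_set {..<n})"
    using symplectic_skew_frame[OF \<omega>1, folded A1_def] by blast
  obtain n2 e f a where fr: "skew_frame A2 UNIV n2 e f a"
    and s2: "sympl_spec_mset \<omega>2 (\<bullet>) = image_mset (\<lambda>i. sqrt (a i)) (mset_set {..<n2})"
    using symplectic_skew_frame[OF \<omega>2, folded A2_def] by blast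
  have eq: "image_mset (\<lambda>i. sqrt (a1 i)) (mset_set {..<n}) = image_mset (\<lambda>i. \<rho> * sqrt (a i)) (mset_set {..<n2})"
    using spec s1 s2 by (simp add: image_mset.compositionality o_def)
  then have n2: "n2 = n" by (metis size_image_mset size_mset_set card_lessThan)
  obtain p where p: "p permutes {..<n}" and pa: "\<And>i. i < n \<Longrightarrow> sqrt (a1 i) = \<rho> * sqrt (a (p i))"
    using image_mset_eq_implies_permutes[OF _ eq[unfolded n2]] by (metis finite_lessThan lessThan_iff)
  have pn: "p i < n" if "i < n" for i using p that by (metis lessThan_iff permutes_in_image)
  have pinj: "p i = p j \<longleftrightarrow> i = j" for i j using p by (metis permutes_inj inj_eq)
  define e2 f2 where "e2 = e \<circ> p" and "f2 = f \<circ> p"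
  have fr2: "skew_frame A2 UNIV n e2 f2 (a \<circ> p)"
    unfolding skew_frame_def
  proof (intro conjI)
    have "(\<Sum>i<n. (x \<bullet> e2 i) *\<^sub>R e2 i + (x \<bullet> f2 i) *\<^sub>R f2 i) = (\<Sum>i<n. (x \<bullet> e i) *\<^sub>R e i + (x \<bullet> f i) *\<^sub>R f i)" for x
      using sum.permute[OF p, of "\<lambda>i. (x \<bullet> e i) *\<^sub>R e i + (x \<bullet> f i) *\<^sub>R f i"] by (simp add: e2_def f2_def o_def)
    then show "\<forall>x\<in>UNIV. x = (\<Sum>i<n. (x \<bullet> e2 i) *\<^sub>R e2 i + (x \<bullet> f2 i) *\<^sub>R f2 i)"
      using fr unfolding skew_frame_def n2 by simp
  qed (use fr pn pinj in \<open>auto simp: skew_frame_def n2 e2_def f2_def\<close>)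
  \<comment> \<open>The spectrum consists of square roots of the frame factors, so
    \<open>\<rho>\<close> enters squared.\<close>
  have aa: "a1 i = \<rho>\<^sup>2 * a (p i)" if "i < n" for i
  proof -
    have "(sqrt (a1 i))\<^sup>2 = (\<rho> * sqrt (a (p i)))\<^sup>2" using pa[OF that] by simp
    then show ?thesis
      using fr1 fr that pn[OF that] by (simp add: power_mult_distrib skew_frame_def n2 less_imp_le)
  qed
  define L where "L v = (\<Sum>i<n. (v \<bullet> e2 i) *\<^sub>R e1 i + (v \<bullet> f2 i) *\<^sub>R f1 i)" for v
  have lin: "linear L"
    by (rule linearI) (simp_all add: L_def inner_add_left scaleR_add_left sum.distrib scaleR_sum_right scaleR_add_right)
  have on1: "e1 i \<bullet> e1 j = (if i = j then 1 else 0)" "f1 i \<bullet> f1 j = (if i = j then 1 else 0)"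
    "e1 i \<bullet> f1 j = 0" "f1 j \<bullet> e1 i = 0" if "i < n" "j < n" for i j
    using fr1 that by (auto simp: skew_frame_def inner_commute)
  have Le: "L v \<bullet> e1 j = v \<bullet> e2 j" and Lf: "L v \<bullet> f1 j = v \<bullet> f2 j" if "j < n" for v j
  proof -
    have "L v \<bullet> e1 j = (\<Sum>i<n. if i = j then v \<bullet> e2 i else 0)"
      unfolding L_def inner_sum_left
      by (rule sum.cong) (use that in \<open>auto simp: on1 inner_add_left\<close>)
    then show "L v \<bullet> e1 j = v \<bullet> e2 j" using that by simp
    have "L v \<bullet> f1 j = (\<Sum>i<n. if i = j then v \<bullet> f2 i else 0)"
      unfolding L_def inner_sum_left
      by (rule sum.cong) (use that in \<open>auto simp: on1 inner_add_left\<close>)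
    then show "L v \<bullet> f1 j = v \<bullet> f2 j" using that by simp
  qed
  have Lg: "L v \<bullet> L w = v \<bullet> w" for v w
    unfolding skew_frame_inner[OF fr1, of "L v" "L w"] skew_frame_inner[OF fr2, of v w]
    by (rule sum.cong) (auto simp: Le Lf)
  have "\<omega>1 (L v) (L w) = \<rho>\<^sup>2 * \<omega>2 v w" for v w
  proof -
    have "\<omega>1 (L v) (L w) = (\<Sum>i<n. (v \<bullet> e2 i) * - (a1 i * (w \<bullet> f2 i)) + (v \<bullet> f2 i) * (a1 i * (w \<bullet> e2 i)))"
      unfolding 1(2) skew_frame_inner[OF fr1, of "L v" "A1 (L w)"]
      by (rule sum.cong) (use fr1 in \<open>auto simp: Le Lf 1(3) skew_frame_def\<close>)
    also have "\<dots> = \<rho>\<^sup>2 * (\<Sum>i<n. (v \<bullet> e2 i) * - (a (p i) * (w \<bullet> f2 i)) + (v \<bullet> f2 i) * (a (p i) * (w \<bullet> e2 i)))"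
      unfolding sum_distrib_left by (rule sum.cong) (auto simp: aa algebra_simps)
    also have "(\<Sum>i<n. (v \<bullet> e2 i) * - (a (p i) * (w \<bullet> f2 i)) + (v \<bullet> f2 i) * (a (p i) * (w \<bullet> e2 i))) = \<omega>2 v w"
      unfolding 2(2) skew_frame_inner[OF fr2, of v "A2 w"]
      by (rule sum.cong) (use fr2 in \<open>auto simp: 2(3) skew_frame_def\<close>)
    finally show ?thesis .
  qed
  moreover have "bij L"
    using similarity_bij[OF lin scalar_product_inner, of 1 "(\<bullet>)"] Lg scalar_product_bilinear[OF scalar_product_inner]
    by simp
  ultimately show ?thesis
    unfolding heis_similar_def using lin Lg \<open>\<rho> > 0\<close>
    by (intro exI[of _ L] exI[of _ "\<rho>\<^sup>2"] exI[of _ 1]) simp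
qed

lemma heis_similar_to_inner:
  fixes \<omega> g :: "'v::euclidean_space \<Rightarrow> 'v \<Rightarrow> real"
  assumes "symplectic_form \<omega>" "scalar_product g"
  obtains T :: "'v \<Rightarrow> 'v" where "linear T" "bij T" "\<And>v w. g (T v) (T w) = v \<bullet> w"
    "symplectic_form (\<lambda>v w. \<omega> (T v) (T w))" "heis_similar \<omega> g (\<lambda>v w. \<omega> (T v) (T w)) (\<bullet>)"
proof -
  obtain T :: "'v \<Rightarrow> 'v" where T: "linear T" "bij T" "\<And>v w. g (T v) (T w) = v \<bullet> w"
    using scalar_product_frame[OF assms(2)] by metis
  show ?thesis
    by (rule that[OF T symplectic_form_pullback[OF assms(1) T(1,2)] heis_similar_pullback[OF T]])
qed

theorem heis_similar_iff_spec:
  fixes \<omega>1 \<omega>2 g1 g2 :: "'v::euclidean_space \<Rightarrow> 'v \<Rightarrow> real"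
  assumes \<omega>1: "symplectic_form \<omega>1" and \<omega>2: "symplectic_form \<omega>2"
    and g1: "scalar_product g1" and g2: "scalar_product g2"
  shows "heis_similar \<omega>1 g1 \<omega>2 g2 \<longleftrightarrow> (\<exists>\<rho>>0. sympl_spec \<omega>1 g1 = map (\<lambda>r. \<rho> * r) (sympl_spec \<omega>2 g2))"
proof
  assume "heis_similar \<omega>1 g1 \<omega>2 g2"
  then show "\<exists>\<rho>>0. sympl_spec \<omega>1 g1 = map (\<lambda>r. \<rho> * r) (sympl_spec \<omega>2 g2)"
    using sympl_spec_similar assms symplectic_form_bilinear by blast
next
  assume "\<exists>\<rho>>0. sympl_spec \<omega>1 g1 = map (\<lambda>r. \<rho> * r) (sympl_spec \<omega>2 g2)"
  then obtain \<rho> where \<rho>: "\<rho> > 0" "sympl_spec \<omega>1 g1 = map (\<lambda>r. \<rho> * r) (sympl_spec \<omega>2 g2)" by blast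
  obtain T1 :: "'v \<Rightarrow> 'v" where T1: "symplectic_form (\<lambda>v w. \<omega>1 (T1 v) (T1 w))"
      "heis_similar \<omega>1 g1 (\<lambda>v w. \<omega>1 (T1 v) (T1 w)) (\<bullet>)" (is "heis_similar _ _ ?\<omega>1 _")
    using heis_similar_to_inner[OF \<omega>1 g1] by metis
  obtain T2 :: "'v \<Rightarrow> 'v" where T2: "symplectic_form (\<lambda>v w. \<omega>2 (T2 v) (T2 w))"
      "heis_similar \<omega>2 g2 (\<lambda>v w. \<omega>2 (T2 v) (T2 w)) (\<bullet>)" (is "heis_similar _ _ ?\<omega>2 _")
    using heis_similar_to_inner[OF \<omega>2 g2] by metis
  \<comment> \<open>\<open>sympl_spec_similar\<close> compares the spectra before and after passing
    to frames only up to positive factors; these are absorbed into the factor of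
    proportionality.\<close>
  obtain \<rho>1 where \<rho>1: "\<rho>1 > 0" "sympl_spec ?\<omega>1 (\<bullet>) = map (\<lambda>r. \<rho>1 * r) (sympl_spec \<omega>1 g1)"
    using sympl_spec_similar[OF scalar_product_inner g1 symplectic_form_bilinear[OF T1(1)]
        symplectic_form_bilinear[OF \<omega>1] heis_similar_sym[OF T1(2)]] by blast
  obtain \<rho>2 where \<rho>2: "\<rho>2 > 0" "sympl_spec \<omega>2 g2 = map (\<lambda>r. \<rho>2 * r) (sympl_spec ?\<omega>2 (\<bullet>))"
    using sympl_spec_similar[OF g2 scalar_product_inner symplectic_form_bilinear[OF \<omega>2]
        symplectic_form_bilinear[OF T2(1)] T2(2)] by blast
  have "sympl_spec ?\<omega>1 (\<bullet>) = map (\<lambda>r. \<rho>1 * \<rho> * \<rho>2 * r) (sympl_spec ?\<omega>2 (\<bullet>))"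
    using \<rho> \<rho>1 \<rho>2 by (simp add: mult.assoc)
  then have "mset (sympl_spec ?\<omega>1 (\<bullet>)) = mset (map (\<lambda>r. \<rho>1 * \<rho> * \<rho>2 * r) (sympl_spec ?\<omega>2 (\<bullet>)))"
    by simp
  then have "sympl_spec_mset ?\<omega>1 (\<bullet>) = image_mset (\<lambda>r. \<rho>1 * \<rho> * \<rho>2 * r) (sympl_spec_mset ?\<omega>2 (\<bullet>))"
    by (simp add: sympl_spec_def)
  then have "heis_similar ?\<omega>1 (\<bullet>) ?\<omega>2 (\<bullet>)"
    using heis_similar_of_spec_inner[OF T1(1) T2(1), of "\<rho>1 * \<rho> * \<rho>2"] \<rho> \<rho>1 \<rho>2 by simp
  then show "heis_similar \<omega>1 g1 \<omega>2 g2"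
    using T1(2) T2(2) heis_similar_trans heis_similar_sym by blast
qed

subsection \<open>Isometries of the Carnot-Caratheodory distance\<close>

lemma heis_mult_assoc:
  "bilinear \<omega> \<Longrightarrow> heis_mult \<omega> (heis_mult \<omega> p q) r = heis_mult \<omega> p (heis_mult \<omega> q r)"
  by (simp add: heis_mult_def bilinear_simps algebra_simps add_divide_distrib)

lemma horiz_curve_similar:
  assumes L: "linear L" and h: "h integrable_on {0..1}" and \<omega>: "\<And>v w. \<omega>1 (L v) (L w) = \<mu> * \<omega>2 v w"
  shows "horiz_curve \<omega>1 (L (fst p), \<mu> * snd p) (L \<circ> h) 1 = (\<lambda>(v, s). (L v, \<mu> * s)) (horiz_curve \<omega>2 p h 1)"
proof -
  have bl: "bounded_linear L" using L by (simp add: linear_conv_bounded_linear)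
  have int: "integral {0..t} (L \<circ> h) = L (integral {0..t} h)" if "t \<in> {0..1}" for t
    using integral_linear[OF _ bl, of h "{0..t}"] integrable_on_subinterval[OF h, of 0 t] that by auto
  have "\<omega>1 (L (fst p) + integral {0..t} (L \<circ> h)) ((L \<circ> h) t) / 2 = \<mu> * (\<omega>2 (fst p + integral {0..t} h) (h t) / 2)"
    if "t \<in> {0..1}" for t
    using int[OF that] \<omega>[of "fst p + integral {0..t} h" "h t"] by (simp add: linear_add[OF L])
  then have "integral {0..1} (\<lambda>t. \<omega>1 (L (fst p) + integral {0..t} (L \<circ> h)) ((L \<circ> h) t) / 2)
    = integral {0..1} (\<lambda>t. \<mu> * (\<omega>2 (fst p + integral {0..t} h) (h t) / 2))"
    by (rule integral_cong)
  then show ?thesis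
    using int[of 1] by (simp add: horiz_curve_def linear_add[OF L] distrib_left)
qed

text \<open>The map \<open>(v, s) \<mapsto> (L v, \<mu> * s)\<close> acts on controls by composition
  with \<open>L\<close>, which preserves lengths and is undone by \<open>inv L\<close>; so both
  infima range over the same set of lengths.\<close>

lemma cc_dist_similar:
  assumes L: "linear L" "bij L" and "\<mu> \<noteq> 0"
    and g: "\<And>v w. g1 (L v) (L w) = g2 v w" and \<omega>: "\<And>v w. \<omega>1 (L v) (L w) = \<mu> * \<omega>2 v w"
  shows "cc_dist \<omega>1 g1 (L (fst p), \<mu> * snd p) (L (fst q), \<mu> * snd q) = cc_dist \<omega>2 g2 p q"
proof -
  have LI: "L (inv L x) = x" for x using L(2) by (simp add: bij_is_surj surj_f_inv_f)
  have IL: "inv L (L x) = x" for x using L(2) by (simp add: bij_is_inj)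
  have "linear (inv L)"
    by (intro linearI) (metis LI IL linear_add[OF L(1)], metis LI IL linear_cmul[OF L(1)])
  then have bl: "bounded_linear L" "bounded_linear (inv L)" using L(1) by (simp_all add: linear_conv_bounded_linear)
  have len: "horiz_length g1 (L \<circ> h) = horiz_length g2 h" for h
    by (simp add: horiz_length_def g)
  have ends: "horiz_curve \<omega>1 (L (fst p), \<mu> * snd p) (L \<circ> h) 1 = (L (fst q), \<mu> * snd q) \<longleftrightarrow> horiz_curve \<omega>2 p h 1 = q"
    if "h absolutely_integrable_on {0..1}" for h
  proof -
    have "h integrable_on {0..1}" using that by (simp add: absolutely_integrable_on_def)
    then have "horiz_curve \<omega>1 (L (fst p), \<mu> * snd p) (L \<circ> h) 1 = (\<lambda>(v, s). (L v, \<mu> * s)) (horiz_curve \<omega>2 p h 1)"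
      by (intro horiz_curve_similar L \<omega>)
    then show ?thesis using \<open>\<mu> \<noteq> 0\<close> IL by (auto simp: case_prod_beta prod_eq_iff) metis
  qed
  have "{horiz_length g1 h |h. h absolutely_integrable_on {0..1} \<and>
          horiz_curve \<omega>1 (L (fst p), \<mu> * snd p) h 1 = (L (fst q), \<mu> * snd q)} =
        {horiz_length g2 h |h. h absolutely_integrable_on {0..1} \<and> horiz_curve \<omega>2 p h 1 = q}" (is "?l = ?r")
  proof (intro set_eqI iffI)
    fix l assume "l \<in> ?r"
    then obtain h where h: "l = horiz_length g2 h" "h absolutely_integrable_on {0..1}" "horiz_curve \<omega>2 p h 1 = q" by blast
    then show "l \<in> ?l"
      using len[of h] ends[OF h(2)] absolutely_integrable_linear[OF h(2) bl(1)]
      by (intro CollectI exI[of _ "L \<circ> h"]) simp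
  next
    fix l assume "l \<in> ?l"
    then obtain h where h: "l = horiz_length g1 h" "h absolutely_integrable_on {0..1}"
      "horiz_curve \<omega>1 (L (fst p), \<mu> * snd p) h 1 = (L (fst q), \<mu> * snd q)" by blast
    have Lh: "L \<circ> (inv L \<circ> h) = h" by (simp add: fun_eq_iff LI)
    have ih: "inv L \<circ> h absolutely_integrable_on {0..1}" by (rule absolutely_integrable_linear[OF h(2) bl(2)])
    show "l \<in> ?r"
      using h ih len[of "inv L \<circ> h"] ends[OF ih] unfolding Lh
      by (intro CollectI exI[of _ "inv L \<circ> h"]) simp
  qed
  then show ?thesis by (simp add: cc_dist_def)
qed

text \<open>Change of variables for running a curve at double speed on the first or on the second
  half of the unit interval, as concatenation requires.\<close>

lemma has_integral_double:
  fixes f :: "real \<Rightarrow> 'a::euclidean_space"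
  assumes "(f has_integral I) {a..b}"
  shows "((\<lambda>t. 2 *\<^sub>R f (2 * t)) has_integral I) {a/2..b/2}"
    "((\<lambda>t. 2 *\<^sub>R f (2 * t - 1)) has_integral I) {(a+1)/2..(b+1)/2}"
proof -
  have "((\<lambda>t. 2 *\<^sub>R f (2 * t + c)) has_integral I) {(a-c)/2..(b-c)/2}" for c
  proof -
    have "cbox ((a - c) /\<^sub>R 2) ((b - c) /\<^sub>R 2) = {(a-c)/2..(b-c)/2}" by (simp add: scaleR_conv_of_real)
    then have "((\<lambda>t. f (2 * t + c)) has_integral (I /\<^sub>R 2)) {(a-c)/2..(b-c)/2}"
      using has_integral_affinity'[of f I a b 2 c] assms by simp
    from has_integral_cmul[OF this, of 2] show ?thesis by simp
  qed
  from this[of 0] this[of "-1"] show "((\<lambda>t. 2 *\<^sub>R f (2 * t)) has_integral I) {a/2..b/2}"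
    "((\<lambda>t. 2 *\<^sub>R f (2 * t - 1)) has_integral I) {(a+1)/2..(b+1)/2}" by simp_all
qed

section \<open>Group law and Carnot-Caratheodory norm for the standard inner product\<close>

locale heisenberg =
  fixes \<omega> :: "'v::euclidean_space \<Rightarrow> 'v \<Rightarrow> real"
  assumes symplectic: "symplectic_form \<omega>"
begin

lemmas bilin = symplectic_form_bilinear[OF symplectic]
lemmas form_simps = bilinear_simps[OF bilin] symplectic_form_self[OF symplectic]
lemmas skew = symplectic_form_skew[OF symplectic]

abbreviation mul :: "'v \<times> real \<Rightarrow> 'v \<times> real \<Rightarrow> 'v \<times> real" (infixl "\<odot>" 70) where
  "p \<odot> q \<equiv> heis_mult \<omega> p q"

text \<open>Since \<open>\<omega> v v = 0\<close>, the group inverse is plain negation in the vector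
  space \<open>V \<times> \<real>\<close>, and the unit is its zero.\<close>

lemma mul_simps [simp]: "0 \<odot> p = p" "p \<odot> 0 = p" "- p \<odot> p = 0" "p \<odot> - p = 0"
  "- p \<odot> (p \<odot> q) = q" "p \<odot> (- p \<odot> q) = q" "- (p \<odot> q) = - q \<odot> - p"
  by (auto simp: heis_mult_def form_simps prod_eq_iff skew[of "fst q" "fst p"] field_simps)

text \<open>Four horizontal moves whose projection closes up: a way to travel along the centre at
  finite cost, and later the way to read the form off a map that respects horizontal
  translations.\<close>

lemma commutator: "(v, 0) \<odot> (w, 0) \<odot> (- v, 0) \<odot> (- w, 0) = (0, \<omega> v w)"
  using skew[of w v] by (simp add: heis_mult_def form_simps)

lemma ex_unit_pair: obtains a b where "\<omega> a b = 1"
proof -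
  obtain v :: 'v where "v \<noteq> 0" using nonempty_Basis nonzero_Basis by blast
  then obtain w where "\<omega> v w \<noteq> 0" using symplectic_form_nondegenerate[OF symplectic] by blast
  then have "\<omega> ((1 / \<omega> v w) *\<^sub>R v) w = 1" by (simp add: form_simps)
  then show ?thesis by (rule that)
qed

text \<open>The primitive of \<open>h\<close> is continuous, hence bounded and measurable, so its
  pairing with \<open>h\<close> is integrable. The central integral in \<open>horiz_curve\<close> is
  therefore genuine for every admissible control.\<close>

lemma absolutely_integrable_form:
  assumes h: "h absolutely_integrable_on {0..1}"
  shows "(\<lambda>t. \<omega> (integral {0..t} h) (h t)) absolutely_integrable_on {0..1::real}"
proof (rule absolutely_integrable_bounded_measurable_product[OF bilin _ _ _ h])
  have "h integrable_on {0..1}" using h by (simp add: absolutely_integrable_on_def)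
  then have cont: "continuous_on {0..1} (\<lambda>t. integral {0..t} h)" by (rule indefinite_integral_continuous_1)
  then show "(\<lambda>t. integral {0..t} h) \<in> borel_measurable (lebesgue_on {0..1})"
    by (rule continuous_imp_measurable_on_sets_lebesgue) simp
  show "bounded ((\<lambda>t. integral {0..t} h) ` {0..1})"
    using cont by (intro compact_imp_bounded compact_continuous_image) auto
qed simp

text \<open>Moving the starting point adds the constant \<open>fst p\<close> to the position, and
  the area this contributes is exactly the cocycle term of the group law.\<close>

lemma horiz_curve_translate:
  assumes h: "h absolutely_integrable_on {0..1}"
  shows "horiz_curve \<omega> p h 1 = p \<odot> horiz_curve \<omega> 0 h 1"
proof -
  have hint: "h integrable_on {0..1}" using h by (simp add: absolutely_integrable_on_def)
  have bl: "bounded_linear (\<omega> (fst p))" using bilin by (simp add: bilinear_def linear_conv_bounded_linear)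
  have i1: "((\<lambda>t. \<omega> (fst p) (h t)) has_integral \<omega> (fst p) (integral {0..1} h)) {0..1}"
    using has_integral_linear[OF integrable_integral[OF hint] bl] by (simp add: o_def)
  have "(\<lambda>t. \<omega> (integral {0..t} h) (h t)) integrable_on {0..1}"
    using absolutely_integrable_form[OF h] by (simp add: absolutely_integrable_on_def)
  then have i2: "((\<lambda>t. \<omega> (integral {0..t} h) (h t)) has_integral integral {0..1} (\<lambda>t. \<omega> (integral {0..t} h) (h t))) {0..1}"
    by (rule integrable_integral)
  have "((\<lambda>t. \<omega> (fst p + integral {0..t} h) (h t)) has_integral
      (\<omega> (fst p) (integral {0..1} h) + integral {0..1} (\<lambda>t. \<omega> (integral {0..t} h) (h t)))) {0..1}"
    using has_integral_add[OF i1 i2] by (simp add: form_simps)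
  then show ?thesis
    by (simp add: horiz_curve_def heis_mult_def integral_unique add_divide_distrib)
qed

text \<open>Keeps a length attached to an actual curve, so that curves can be concatenated before
  any infimum is taken.\<close>

definition reach :: "'v \<times> real \<Rightarrow> real \<Rightarrow> bool" where
  "reach p l \<longleftrightarrow> (\<exists>h. h absolutely_integrable_on {0..1} \<and> horiz_curve \<omega> 0 h 1 = p \<and> horiz_length (\<bullet>) h = l)"

definition cc_norm :: "'v \<times> real \<Rightarrow> real" where
  "cc_norm p = Inf {l. reach p l}"

lemma cc_dist_eq_cc_norm: "cc_dist \<omega> (\<bullet>) p q = cc_norm (- p \<odot> q)"
proof -
  have "p \<odot> c = q \<longleftrightarrow> c = - p \<odot> q" for c using mul_simps(5,6) by metis
  then have "horiz_curve \<omega> p h 1 = q \<longleftrightarrow> horiz_curve \<omega> 0 h 1 = - p \<odot> q" if "h absolutely_integrable_on {0..1}" for h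
    using horiz_curve_translate[OF that, of p] by simp
  then have "{horiz_length (\<bullet>) h |h. h absolutely_integrable_on {0..1} \<and> horiz_curve \<omega> p h 1 = q} = {l. reach (- p \<odot> q) l}"
    unfolding reach_def by (intro set_eqI) (auto; metis)
  then show ?thesis by (simp add: cc_dist_def cc_norm_def)
qed

lemma reach_horizontal: "reach (v, 0) (norm v)"
  unfolding reach_def
proof (intro exI[of _ "\<lambda>_. v"] conjI)
  have "integral {0..1} (\<lambda>t::real. \<omega> (integral {0..t} (\<lambda>_. v)) v) = integral {0..1} (\<lambda>t::real. 0)"
    by (rule integral_cong) (simp add: form_simps)
  then show "horiz_curve \<omega> 0 (\<lambda>_. v) 1 = (v, 0)" by (simp add: horiz_curve_def)
qed (auto simp: horiz_length_def norm_eq_sqrt_inner absolutely_integrable_on_def integrable_const_ivl)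

text \<open>Concatenation: the curve for \<open>p\<close> at double speed, followed by the left
  translate by \<open>p\<close> of the curve for \<open>q\<close>.\<close>

lemma reach_mul:
  assumes "reach p l" "reach q m"
  shows "reach (p \<odot> q) (l + m)"
proof -
  obtain h where h: "h absolutely_integrable_on {0..1}" "horiz_curve \<omega> 0 h 1 = p" "horiz_length (\<bullet>) h = l"
    using assms(1) unfolding reach_def by blast
  obtain k where k: "k absolutely_integrable_on {0..1}" "horiz_curve \<omega> 0 k 1 = q" "horiz_length (\<bullet>) k = m"
    using assms(2) unfolding reach_def by blast
  define H where "H t = integral {0..t} h" for t
  define K where "K t = integral {0..t} k" for t
  have hI: "(h has_integral H t) {0..t}" and kI: "(k has_integral K t) {0..t}" if "0 \<le> t" "t \<le> 1" for t
    using that h(1) k(1) unfolding H_def K_def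
    by (auto simp: absolutely_integrable_on_def intro!: integrable_integral intro: integrable_on_subinterval)
  have nI: "((\<lambda>t. norm (h t)) has_integral l) {0..1}" "((\<lambda>t. norm (k t)) has_integral m) {0..1}"
    using h k by (auto simp: absolutely_integrable_on_def horiz_length_def norm_eq_sqrt_inner[symmetric] has_integral_iff)
  have p: "p = (H 1, integral {0..1} (\<lambda>t. \<omega> (H t) (h t) / 2))" and q: "q = (K 1, integral {0..1} (\<lambda>t. \<omega> (K t) (k t) / 2))"
    using h(2) k(2) by (auto simp: horiz_curve_def H_def K_def)
  have aI: "((\<lambda>t. \<omega> (H t) (h t) / 2) has_integral snd p) {0..1}"
    using absolutely_integrable_form[OF h(1)]
    by (simp add: p absolutely_integrable_on_def H_def integrable_integral has_integral_divide)
  have kI': "((\<lambda>t. \<omega> (K t) (k t) / 2) has_integral snd q) {0..1}"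
    using absolutely_integrable_form[OF k(1)]
    by (simp add: q absolutely_integrable_on_def K_def integrable_integral has_integral_divide)
  have "bounded_linear (\<omega> (H 1))" using bilin by (simp add: bilinear_def linear_conv_bounded_linear)
  from has_integral_linear[OF kI[of 1] this] have HkI: "((\<lambda>t. \<omega> (H 1) (k t) / 2) has_integral (\<omega> (H 1) (K 1) / 2)) {0..1}"
    by (simp add: o_def has_integral_divide)
  \<comment> \<open>Central increment of the second piece, where the position is
    \<open>H 1 + K t\<close>; the cross term with \<open>H 1\<close> is the cocycle of the
    product.\<close>
  have bI: "((\<lambda>t. \<omega> (H 1 + K t) (k t) / 2) has_integral (snd q + \<omega> (H 1) (K 1) / 2)) {0..1}"
    using has_integral_add[OF HkI kI'] by (simp add: form_simps add_divide_distrib add.commute)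
  define c where "c t = (if t \<le> 1/2 then 2 *\<^sub>R h (2 * t) else 2 *\<^sub>R k (2 * t - 1))" for t
  \<comment> \<open>At time 1/2 the branch for \<open>h\<close> is taken, so on the second half
    \<open>c\<close> agrees with the formula for \<open>k\<close> only off this point.\<close>
  have neg: "negligible {1/2::real}" by simp
  have low: "(c has_integral H (2 * t)) {0..t}" if "0 \<le> t" "t \<le> 1/2" for t
  proof -
    have "((\<lambda>t. 2 *\<^sub>R h (2 * t)) has_integral H (2 * t)) {0..t}"
      using has_integral_double(1)[OF hI[of "2 * t"]] that by simp
    then show ?thesis
      by (rule has_integral_eq[rotated]) (use that in \<open>auto simp: c_def\<close>)
  qed
  have high: "(c has_integral (H 1 + K (2 * t - 1))) {0..t}" if "1/2 \<le> t" "t \<le> 1" for t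
  proof -
    have "((\<lambda>t. 2 *\<^sub>R k (2 * t - 1)) has_integral K (2 * t - 1)) {1/2..t}"
      using has_integral_double(2)[OF kI[of "2 * t - 1"]] that by simp
    then have "(c has_integral K (2 * t - 1)) {1/2..t}"
      by (rule has_integral_spike[OF neg, rotated]) (use that in \<open>auto simp: c_def\<close>)
    moreover have "(c has_integral H 1) {0..1/2}" using low[of "1/2"] by simp
    ultimately show ?thesis using has_integral_combine[of 0 "1/2" t c] that by simp
  qed
  have "((\<lambda>t. 2 *\<^sub>R norm (h (2 * t))) has_integral l) {0..1/2}"
    using has_integral_double(1)[OF nI(1)] by simp
  then have "((\<lambda>t. norm (c t)) has_integral l) {0..1/2}"
    by (rule has_integral_eq[rotated]) (auto simp: c_def)
  moreover have "((\<lambda>t. 2 *\<^sub>R norm (k (2 * t - 1))) has_integral m) {1/2..1}"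
    using has_integral_double(2)[OF nI(2)] by simp
  then have "((\<lambda>t. norm (c t)) has_integral m) {1/2..1}"
    by (rule has_integral_spike[OF neg, rotated]) (auto simp: c_def)
  ultimately have cn: "((\<lambda>t. norm (c t)) has_integral (l + m)) {0..1}"
    using has_integral_combine[of 0 "1/2" 1 "\<lambda>t. norm (c t)"] by simp
  have "((\<lambda>t. 2 *\<^sub>R (\<omega> (H (2 * t)) (h (2 * t)) / 2)) has_integral snd p) {0..1/2}"
    using has_integral_double(1)[OF aI] by simp
  then have "((\<lambda>t. \<omega> (integral {0..t} c) (c t) / 2) has_integral snd p) {0..1/2}"
    by (rule has_integral_eq[rotated]) (auto simp: c_def form_simps integral_unique[OF low])
  moreover have "((\<lambda>t. 2 *\<^sub>R (\<omega> (H 1 + K (2 * t - 1)) (k (2 * t - 1)) / 2)) has_integral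
      (snd q + \<omega> (H 1) (K 1) / 2)) {1/2..1}"
    using has_integral_double(2)[OF bI] by simp
  then have "((\<lambda>t. \<omega> (integral {0..t} c) (c t) / 2) has_integral (snd q + \<omega> (H 1) (K 1) / 2)) {1/2..1}"
    by (rule has_integral_spike[OF neg, rotated]) (auto simp: c_def form_simps integral_unique[OF high])
  ultimately have ca: "((\<lambda>t. \<omega> (integral {0..t} c) (c t) / 2) has_integral (snd p + (snd q + \<omega> (H 1) (K 1) / 2))) {0..1}"
    using has_integral_combine[of 0 "1/2" 1 "\<lambda>t. \<omega> (integral {0..t} c) (c t) / 2"] by simp
  have "c absolutely_integrable_on {0..1}"
    using cn high[of 1] by (auto simp: absolutely_integrable_on_def has_integral_iff)
  moreover have "horiz_curve \<omega> 0 c 1 = p \<odot> q"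
    using integral_unique[OF high[of 1]] integral_unique[OF ca] p q
    by (simp add: horiz_curve_def heis_mult_def prod_eq_iff)
  moreover have "horiz_length (\<bullet>) c = l + m"
    using integral_unique[OF cn] by (simp add: horiz_length_def norm_eq_sqrt_inner)
  ultimately show ?thesis unfolding reach_def by blast
qed

lemma reach_ge: "reach p l \<Longrightarrow> norm (fst p) \<le> l"
proof -
  assume "reach p l"
  then obtain h where h: "h absolutely_integrable_on {0..1}" "horiz_curve \<omega> 0 h 1 = p" "horiz_length (\<bullet>) h = l"
    unfolding reach_def by blast
  then have "fst p = integral {0..1} h" "l = integral {0..1} (\<lambda>t. norm (h t))"
    by (auto simp: horiz_curve_def horiz_length_def norm_eq_sqrt_inner)
  then show ?thesis
    using integral_norm_bound_integral[of h "{0..1}" "\<lambda>t. norm (h t)"] h(1) by (simp add: absolutely_integrable_on_def)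
qed

lemma form_bound: obtains B where "B > 0" "\<And>v w. \<bar>\<omega> v w\<bar> \<le> B * norm v * norm w"
  using bilinear_bounded_pos[OF bilin] by auto

text \<open>The projection stays in the ball of radius \<open>l\<close> about 0, so the central
  coordinate changes at a rate of at most \<open>B * l * norm (h t)\<close>.\<close>

lemma reach_area:
  assumes B: "B > 0" "\<And>v w. \<bar>\<omega> v w\<bar> \<le> B * norm v * norm w" and "reach p l"
  shows "\<bar>snd p\<bar> \<le> B * l\<^sup>2"
proof -
  obtain h where h: "h absolutely_integrable_on {0..1}" "horiz_curve \<omega> 0 h 1 = p" "horiz_length (\<bullet>) h = l"
    using assms(3) unfolding reach_def by blast
  have hi: "h integrable_on {0..1}" "(\<lambda>t. norm (h t)) integrable_on {0..1}"
    using h(1) by (auto simp: absolutely_integrable_on_def)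
  have l: "l = integral {0..1} (\<lambda>t. norm (h t))"
    using h by (auto simp: horiz_length_def norm_eq_sqrt_inner)
  have H: "norm (integral {0..t} h) \<le> l" if "t \<in> {0..1}" for t
  proof -
    have "norm (integral {0..t} h) \<le> integral {0..t} (\<lambda>t. norm (h t))"
      using that hi by (intro integral_norm_bound_integral) (auto intro: integrable_on_subinterval)
    also have "\<dots> \<le> l"
      unfolding l using that hi by (intro integral_subset_le) (auto intro: integrable_on_subinterval)
    finally show ?thesis .
  qed
  have "snd p = integral {0..1} (\<lambda>t. \<omega> (integral {0..t} h) (h t) / 2)"
    using h(2) by (auto simp: horiz_curve_def)
  also have "norm \<dots> \<le> integral {0..1} (\<lambda>t. B * l * norm (h t))"
  proof (rule integral_norm_bound_integral)
    show "(\<lambda>t. \<omega> (integral {0..t} h) (h t) / 2) integrable_on {0..1}"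
      using absolutely_integrable_form[OF h(1)] by (auto simp: absolutely_integrable_on_def)
    show "(\<lambda>t. B * l * norm (h t)) integrable_on {0..1}" using hi(2) by (rule integrable_on_mult_right)
    fix t :: real assume t: "t \<in> {0..1}"
    have "\<bar>\<omega> (integral {0..t} h) (h t)\<bar> \<le> B * norm (integral {0..t} h) * norm (h t)" by (rule B)
    also have "\<dots> \<le> B * l * norm (h t)" using H[OF t] B(1) by (intro mult_right_mono mult_left_mono) auto
    finally show "norm (\<omega> (integral {0..t} h) (h t) / 2) \<le> B * l * norm (h t)" by simp
  qed
  also have "\<dots> = B * l\<^sup>2" by (simp add: l[symmetric] power2_eq_square)
  finally show ?thesis by simp
qed

text \<open>Go straight to the projection, then run a commutator loop whose sides scale like
  \<open>sqrt \<bar>snd p\<bar>\<close>. In particular \<open>cc_norm\<close> is an infimum over a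
  nonempty set.\<close>

lemma reach_upper:
  obtains C where "C \<ge> 0" "\<And>p. \<exists>l. reach p l \<and> l \<le> norm (fst p) + C * sqrt \<bar>snd p\<bar>"
proof -
  obtain a b where ab: "\<omega> a b = 1" by (rule ex_unit_pair)
  define C where "C = 2 * (norm a + norm b)"
  have "\<exists>l. reach p l \<and> l \<le> norm (fst p) + C * sqrt \<bar>snd p\<bar>" for p
  proof -
    obtain x s where p: "p = (x, s)" by force
    define v where "v = sqrt \<bar>s\<bar> *\<^sub>R a"
    define w where "w = (sgn s * sqrt \<bar>s\<bar>) *\<^sub>R b"
    have "\<omega> v w = s" by (simp add: v_def w_def form_simps ab sgn_if)
    then have "(x, 0) \<odot> ((v, 0) \<odot> (w, 0) \<odot> (- v, 0) \<odot> (- w, 0)) = p"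
      by (simp only: commutator) (simp add: p heis_mult_def form_simps)
    moreover have "reach ((x, 0) \<odot> ((v, 0) \<odot> (w, 0) \<odot> (- v, 0) \<odot> (- w, 0)))
        (norm x + (norm v + norm w + norm (- v) + norm (- w)))"
      by (intro reach_mul reach_horizontal)
    moreover have "norm v = sqrt \<bar>s\<bar> * norm a" "norm w \<le> sqrt \<bar>s\<bar> * norm b"
      by (auto simp: v_def w_def abs_mult sgn_if)
    ultimately show ?thesis
      by (intro exI[of _ "norm x + (norm v + norm w + norm (- v) + norm (- w))"])
        (auto simp: p C_def algebra_simps)
  qed
  moreover have "C \<ge> 0" by (simp add: C_def)
  ultimately show ?thesis using that by blast
qed

lemma reach_nonempty: "{l. reach p l} \<noteq> {}"
  using reach_upper by (metis empty_Collect_eq)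

lemma bdd_below_reach: "bdd_below {l. reach p l}"
  by (rule bdd_belowI[of _ "norm (fst p)"]) (use reach_ge in auto)

lemma cc_norm_le: "reach p l \<Longrightarrow> cc_norm p \<le> l"
  unfolding cc_norm_def by (rule cInf_lower) (auto intro: bdd_below_reach)

lemma le_cc_norm: "(\<And>l. reach p l \<Longrightarrow> c \<le> l) \<Longrightarrow> c \<le> cc_norm p"
  unfolding cc_norm_def by (rule cInf_greatest[OF reach_nonempty]) auto

lemma cc_norm_ge: "norm (fst p) \<le> cc_norm p"
  by (rule le_cc_norm) (rule reach_ge)

lemma cc_norm_horizontal [simp]: "cc_norm (v, 0) = norm v"
  using cc_norm_le[OF reach_horizontal[of v]] cc_norm_ge[of "(v, 0)"] by simp

lemma cc_norm_mul: "cc_norm (p \<odot> q) \<le> cc_norm p + cc_norm q"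
proof -
  have "cc_norm (p \<odot> q) - m \<le> l" if "reach p l" "reach q m" for l m
    using cc_norm_le[OF reach_mul[OF that]] by simp
  then have "cc_norm (p \<odot> q) - m \<le> cc_norm p" if "reach q m" for m
    using that by (intro le_cc_norm)
  then have "cc_norm (p \<odot> q) - cc_norm p \<le> m" if "reach q m" for m
    using that by (simp add: algebra_simps)
  then have "cc_norm (p \<odot> q) - cc_norm p \<le> cc_norm q" by (rule le_cc_norm)
  then show ?thesis by simp
qed

lemma cc_norm_area:
  obtains C where "C > 0" "\<And>p. \<bar>snd p\<bar> \<le> C * (cc_norm p)\<^sup>2"
proof -
  obtain B where B: "B > 0" "\<And>v w. \<bar>\<omega> v w\<bar> \<le> B * norm v * norm w" by (rule form_bound) blast
  have "\<bar>snd p\<bar> \<le> B * (cc_norm p)\<^sup>2" for p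
  proof -
    have "sqrt (\<bar>snd p\<bar> / B) \<le> cc_norm p"
    proof (rule le_cc_norm)
      fix l assume l: "reach p l"
      then have "\<bar>snd p\<bar> / B \<le> l\<^sup>2" using reach_area[OF B l] B(1) by (simp add: field_simps)
      moreover have "l \<ge> 0" using reach_ge[OF l] norm_ge_zero order_trans by blast
      ultimately show "sqrt (\<bar>snd p\<bar> / B) \<le> l" by (rule real_le_lsqrt[rotated])
    qed
    then have "(sqrt (\<bar>snd p\<bar> / B))\<^sup>2 \<le> (cc_norm p)\<^sup>2" using B(1) by (intro power_mono) auto
    then show ?thesis using B(1) by (simp add: field_simps)
  qed
  then show ?thesis using that B(1) by blast
qed

lemma cc_norm_upper:
  obtains C where "C \<ge> 0" "\<And>p. cc_norm p \<le> norm (fst p) + C * sqrt \<bar>snd p\<bar>"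
proof -
  obtain C where "C \<ge> 0" "\<And>p. \<exists>l. reach p l \<and> l \<le> norm (fst p) + C * sqrt \<bar>snd p\<bar>" by (rule reach_upper) blast
  then show ?thesis using that cc_norm_le order_trans by metis
qed

section \<open>Geodesic rays and their Busemann functions\<close>

lemma ex_form_eq:
  obtains m where "m > 0" "\<And>y \<sigma>. y \<noteq> 0 \<Longrightarrow> \<exists>z. \<omega> z y = \<sigma> \<and> m * norm y * norm z \<le> \<bar>\<sigma>\<bar>"
proof -
  define A where "A = A_op \<omega> (\<bullet>)"
  note op = symplectic_form_op[OF symplectic, folded A_def]
  have "inj A" using op(1,4) by (simp add: linear_injective_0)
  then obtain m where m: "m > 0" "\<And>x. m * norm x \<le> norm (A x)"
    using linear_inj_bounded_below_pos[OF op(1)] by metis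
  have "\<exists>z. \<omega> z y = \<sigma> \<and> m * norm y * norm z \<le> \<bar>\<sigma>\<bar>" if "y \<noteq> 0" for y \<sigma>
  proof (intro exI conjI)
    \<comment> \<open>The multiple of \<open>A y\<close> that pairs with \<open>y\<close> to
      \<open>\<sigma>\<close>. Its length is \<open>\<bar>\<sigma>\<bar> / norm (A y)\<close>, so
      the longer \<open>y\<close>, the cheaper the correction.\<close>
    let ?z = "(\<sigma> / (norm (A y))\<^sup>2) *\<^sub>R A y"
    have Ay: "norm (A y) > 0" using op(4)[of y] that by auto
    show "\<omega> ?z y = \<sigma>" using Ay by (simp add: op(2) power2_norm_eq_inner[symmetric])
    have "m * norm y * norm ?z \<le> norm (A y) * norm ?z" using m(2) by (intro mult_right_mono) auto
    also have "\<dots> = \<bar>\<sigma>\<bar>" using Ay by (simp add: power2_eq_square)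
    finally show "m * norm y * norm ?z \<le> \<bar>\<sigma>\<bar>" .
  qed
  then show ?thesis using that m(1) by blast
qed

text \<open>Conjugation by \<open>(z, 0)\<close> adds \<open>\<omega> z y\<close> to the central
  coordinate of \<open>(y, \<tau>)\<close>. A central defect \<open>\<sigma>\<close> can thus be
  produced at the cost of two segments of length \<open>norm z\<close>.\<close>

lemma mul_via_conjugation:
  assumes "\<omega> z y = \<sigma>"
  shows "(x, \<sigma>) \<odot> (y, \<tau>) = (x, 0) \<odot> (z, 0) \<odot> (y, \<tau>) \<odot> (- z, 0)"
  using assms skew[of y z] by (simp add: heis_mult_def form_simps field_simps)

text \<open>If the projection stayed bounded, each unit of time would change the central coordinate
  by a bounded amount. It would grow at most linearly, and the distance at most like the square root
  of time, too slowly for a ray.\<close>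

lemma ray_unbounded:
  assumes ray: "\<And>s t. 0 \<le> s \<Longrightarrow> s \<le> t \<Longrightarrow> cc_norm (- \<gamma> s \<odot> \<gamma> t) = t - s"
  shows "\<exists>n::nat. norm (fst (\<gamma> (real n))) > R"
proof (rule ccontr)
  assume "\<not> ?thesis"
  then have R: "norm (fst (\<gamma> (real n))) \<le> R" for n by (simp add: not_less)
  obtain B where B: "B > 0" "\<And>v w. \<bar>\<omega> v w\<bar> \<le> B * norm v * norm w" by (rule form_bound) blast
  obtain C where C: "C > 0" "\<And>p. \<bar>snd p\<bar> \<le> C * (cc_norm p)\<^sup>2" by (rule cc_norm_area) blast
  obtain D where D: "D \<ge> 0" "\<And>p. cc_norm p \<le> norm (fst p) + D * sqrt \<bar>snd p\<bar>" by (rule cc_norm_upper) blast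
  have R0: "R \<ge> 0" using R[of 0] norm_ge_zero order_trans by blast
  define x where "x n = fst (\<gamma> (real n))" for n
  define s where "s n = snd (\<gamma> (real n))" for n
  have inc: "- \<gamma> (real m) \<odot> \<gamma> (real n) = (x n - x m, s n - s m - \<omega> (x m) (x n) / 2)" for m n
    by (simp add: heis_mult_def x_def s_def form_simps)
  have \<omega>R: "\<bar>\<omega> (x m) (x n)\<bar> \<le> B * R\<^sup>2" for m n
  proof -
    have "B * norm (x m) * norm (x n) \<le> B * R * R"
      using R B(1) R0 by (intro mult_mono) (auto simp: x_def)
    then show ?thesis using B(2)[of "x m" "x n"] by (simp add: power2_eq_square)
  qed
  \<comment> \<open>Bound for one unit step: \<open>C\<close> from the central part of the
    increment, the rest from the cocycle term between bounded positions.\<close>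
  define K where "K = C + B * R\<^sup>2"
  have K0: "K \<ge> 0" using B(1) C(1) by (simp add: K_def)
  have step: "\<bar>s (Suc n) - s n\<bar> \<le> K" for n
    using C(2)[of "- \<gamma> (real n) \<odot> \<gamma> (real (Suc n))"] ray[of "real n" "real (Suc n)"] \<omega>R[of n "Suc n"]
    unfolding inc K_def by simp
  have sn: "\<bar>s n - s 0\<bar> \<le> K * n" for n
  proof (induction n)
    case (Suc n)
    then show ?case using step[of n] by (simp add: algebra_simps)
  qed simp
  define M where "M = D * sqrt (2 * K)"
  \<comment> \<open>At the square times \<open>k\<^sup>2\<close> the square root is linear in
    \<open>k\<close>, and the quadratic left side wins for large \<open>k\<close>.\<close>
  have M: "real (k\<^sup>2) \<le> 2 * R + M * k" if "k \<ge> 1" for k :: nat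
  proof -
    let ?n = "k\<^sup>2"
    have n1: "real ?n \<ge> 1" using that by simp
    have "\<bar>s ?n - s 0 - \<omega> (x 0) (x ?n) / 2\<bar> \<le> K * real ?n + K"
      using sn[of ?n] \<omega>R[of 0 ?n] C(1) B(1) by (simp add: K_def)
    also have "\<dots> \<le> 2 * K * real ?n" using mult_left_mono[OF n1 K0] by simp
    finally have "sqrt \<bar>s ?n - s 0 - \<omega> (x 0) (x ?n) / 2\<bar> \<le> sqrt (2 * K * real ?n)" by simp
    also have "\<dots> = sqrt (2 * K) * k" by (simp add: real_sqrt_mult)
    finally have "D * sqrt \<bar>s ?n - s 0 - \<omega> (x 0) (x ?n) / 2\<bar> \<le> M * k"
      using D(1) by (simp add: M_def mult.assoc mult_left_mono)
    moreover have "norm (x ?n - x 0) \<le> 2 * R"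
      using norm_triangle_ineq4[of "x ?n" "x 0"] R[of ?n] R[of 0] by (simp add: x_def)
    moreover have "real ?n \<le> norm (x ?n - x 0) + D * sqrt \<bar>s ?n - s 0 - \<omega> (x 0) (x ?n) / 2\<bar>"
      using ray[of 0 "real ?n"] D(2)[of "- \<gamma> (real 0) \<odot> \<gamma> (real ?n)"] inc[of 0 ?n] by simp
    ultimately show ?thesis by linarith
  qed
  obtain k :: nat where k: "real k > 2 * R + M + 1" using reals_Archimedean2 by blast
  have M0: "M \<ge> 0" using D(1) K0 by (simp add: M_def)
  have "k \<ge> 1" using k R0 M0 by linarith
  have "(2 * R + M + 1) * k \<le> real k * k" using k by (intro mult_right_mono) auto
  moreover have "2 * R * 1 \<le> 2 * R * k" using R0 \<open>k \<ge> 1\<close> by (intro mult_left_mono) auto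
  ultimately show False using M[OF \<open>k \<ge> 1\<close>] \<open>k \<ge> 1\<close> by (simp add: power2_eq_square algebra_simps)
qed

text \<open>Let \<open>\<epsilon>\<close> be what a straight segment from time \<open>s\<close> to
  time \<open>t\<close> would save and \<open>\<sigma>\<close> the central defect it leaves.
  Repairing the defect beyond time \<open>t\<close> costs \<open>2 * norm z\<close>, at most
  \<open>2 * \<bar>\<sigma>\<bar> / (m * norm y)\<close>, which is below \<open>\<epsilon>\<close>
  once the ray is far out.\<close>

lemma ray_projection_isometric:
  assumes ray: "\<And>s t. 0 \<le> s \<Longrightarrow> s \<le> t \<Longrightarrow> cc_norm (- \<gamma> s \<odot> \<gamma> t) = t - s" and st: "0 \<le> s" "s \<le> t"
  shows "norm (fst (\<gamma> t) - fst (\<gamma> s)) = t - s"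
proof (rule ccontr)
  assume neq: "\<not> ?thesis"
  define x where "x t = fst (\<gamma> t)" for t
  have inc1: "fst (- \<gamma> a \<odot> \<gamma> b) = x b - x a" for a b by (simp add: heis_mult_def x_def)
  have le: "norm (x b - x a) \<le> b - a" if "0 \<le> a" "a \<le> b" for a b
    using cc_norm_ge[of "- \<gamma> a \<odot> \<gamma> b"] ray[OF that] by (simp add: inc1)
  define \<epsilon> where "\<epsilon> = t - s - norm (x t - x s)"
  have \<epsilon>: "\<epsilon> > 0" using le[OF st] neq by (simp add: \<epsilon>_def x_def)
  define \<sigma> where "\<sigma> = snd (- \<gamma> s \<odot> \<gamma> t)"
  obtain m where m: "m > 0" "\<And>y \<sigma>. y \<noteq> 0 \<Longrightarrow> \<exists>z. \<omega> z y = \<sigma> \<and> m * norm y * norm z \<le> \<bar>\<sigma>\<bar>" by (rule ex_form_eq) blast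
  \<comment> \<open>One choice serves two purposes: \<open>y\<close> becomes long enough for a
    repair cheaper than \<open>\<epsilon>\<close>, and \<open>n\<close> lies beyond \<open>t\<close>
    because the projection has speed at most 1.\<close>
  obtain n :: nat where n: "norm (x n) > norm (x 0) + t + norm (x t) + 2 * \<bar>\<sigma>\<bar> / (m * \<epsilon>)"
    using ray_unbounded[of \<gamma>, OF ray] unfolding x_def by blast
  define y where "y = x n - x t"
  have q0: "2 * \<bar>\<sigma>\<bar> / (m * \<epsilon>) \<ge> 0" using m(1) \<epsilon> by simp
  have nt: "t \<le> n"
  proof -
    have "norm (x n - x 0) \<le> n" using le[of 0 n] by simp
    then show ?thesis using norm_triangle_sub[of "x n" "x 0"] n q0 norm_ge_zero[of "x t"] by linarith
  qed
  have y: "norm y > 2 * \<bar>\<sigma>\<bar> / (m * \<epsilon>)"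
    using n norm_triangle_sub[of "x n" "x t"] norm_ge_zero[of "x 0"] st unfolding y_def by linarith
  then have "y \<noteq> 0" using q0 by auto
  then obtain z where z: "\<omega> z y = \<sigma>" "m * norm y * norm z \<le> \<bar>\<sigma>\<bar>" using m(2) by blast
  define \<tau> where "\<tau> = snd (- \<gamma> t \<odot> \<gamma> n)"
  have "- \<gamma> s \<odot> \<gamma> n = (- \<gamma> s \<odot> \<gamma> t) \<odot> (- \<gamma> t \<odot> \<gamma> n)"
    by (simp add: heis_mult_assoc[OF bilin])
  also have "\<dots> = (x t - x s, \<sigma>) \<odot> (y, \<tau>)"
    by (metis inc1 \<sigma>_def \<tau>_def y_def prod.collapse)
  also have "\<dots> = (x t - x s, 0) \<odot> (z, 0) \<odot> (y, \<tau>) \<odot> (- z, 0)"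
    by (rule mul_via_conjugation[OF z(1)])
  finally have "cc_norm (- \<gamma> s \<odot> \<gamma> n) \<le> norm (x t - x s) + norm z + cc_norm (y, \<tau>) + norm z"
    using cc_norm_mul[of "(x t - x s, 0) \<odot> (z, 0) \<odot> (y, \<tau>)" "(- z, 0)"]
      cc_norm_mul[of "(x t - x s, 0) \<odot> (z, 0)" "(y, \<tau>)"] cc_norm_mul[of "(x t - x s, 0)" "(z, 0)"]
    by simp
  moreover have "(y, \<tau>) = - \<gamma> t \<odot> \<gamma> n" by (metis inc1 \<tau>_def y_def prod.collapse)
  ultimately have "n - s \<le> norm (x t - x s) + 2 * norm z + (n - t)"
    using ray[of s n] ray[of t n] st nt by simp
  then have "\<epsilon> \<le> 2 * norm z" by (simp add: \<epsilon>_def)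
  then have "m * norm y * \<epsilon> \<le> m * norm y * (2 * norm z)" using m(1) by (intro mult_left_mono) auto
  also have "\<dots> \<le> 2 * \<bar>\<sigma>\<bar>" using z(2) by simp
  finally show False using y m(1) \<epsilon> by (simp add: field_simps)
qed

text \<open>Cutting the interval into \<open>n\<close> equal pieces bounds the total change by
  \<open>C * t\<^sup>2 / n\<close>, for every positive \<open>n\<close>.\<close>

lemma quadratic_increments_zero:
  fixes \<sigma> :: "real \<Rightarrow> real"
  assumes "\<sigma> 0 = 0" "C \<ge> 0" and inc: "\<And>s t. 0 \<le> s \<Longrightarrow> s \<le> t \<Longrightarrow> \<bar>\<sigma> t - \<sigma> s\<bar> \<le> C * (t - s)\<^sup>2" and "t \<ge> 0"
  shows "\<sigma> t = 0"
proof -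
  have bound: "\<bar>\<sigma> t\<bar> * n \<le> C * t\<^sup>2" if "n \<ge> 1" for n :: nat
  proof -
    define d where "d = t / n"
    have d: "d \<ge> 0" "d * n = t" using assms(4) that by (auto simp: d_def)
    have "\<bar>\<sigma> (k * d)\<bar> \<le> k * (C * d\<^sup>2)" for k :: nat
    proof (induction k)
      case (Suc k)
      have "\<bar>\<sigma> (Suc k * d) - \<sigma> (k * d)\<bar> \<le> C * d\<^sup>2"
        using inc[of "k * d" "Suc k * d"] d(1) by (simp add: algebra_simps)
      then show ?case using Suc by (simp add: algebra_simps)
    qed (simp add: assms)
    from this[of n] have "\<bar>\<sigma> t\<bar> \<le> n * (C * d\<^sup>2)" using d(2) by (simp add: mult.commute)
    then have "\<bar>\<sigma> t\<bar> * n \<le> n * (C * d\<^sup>2) * n" by (rule mult_right_mono) simp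
    also have "\<dots> = C * t\<^sup>2" unfolding d(2)[symmetric] by (simp add: power2_eq_square)
    finally show ?thesis .
  qed
  show ?thesis
  proof (rule ccontr)
    assume "\<sigma> t \<noteq> 0"
    then obtain n :: nat where n: "C * t\<^sup>2 / \<bar>\<sigma> t\<bar> < n" using reals_Archimedean2 by blast
    moreover have "C * t\<^sup>2 / \<bar>\<sigma> t\<bar> \<ge> 0" using assms(2) by simp
    ultimately have "n \<ge> 1" by (cases n) auto
    from bound[OF this] n \<open>\<sigma> t \<noteq> 0\<close> show False by (simp add: field_simps)
  qed
qed

text \<open>The only geodesic rays are horizontal lines: a bent initial piece could be replaced by a straight one,
  and the resulting defect in the centre is repaired far away at arbitrarily small cost by conjugation.\<close>
theorem ray_horizontal:
  assumes ray: "\<And>s t. 0 \<le> s \<Longrightarrow> s \<le> t \<Longrightarrow> cc_norm (- \<gamma> s \<odot> \<gamma> t) = t - s"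
  shows "\<exists>e. norm e = 1 \<and> (\<forall>t\<ge>0. \<gamma> t = \<gamma> 0 \<odot> (t *\<^sub>R e, 0))"
proof -
  define x where "x t = fst (\<gamma> t) - fst (\<gamma> 0)" for t
  have iso: "norm (x t - x s) = t - s" if "0 \<le> s" "s \<le> t" for s t
    using ray_projection_isometric[of \<gamma>, OF ray that] by (simp add: x_def)
  have x0: "x 0 = 0" by (simp add: x_def)
  define e where "e = x 1"
  have e: "norm e = 1" using iso[of 0 1] by (simp add: e_def x0)
  \<comment> \<open>Equality in the triangle inequality, for the times 0, \<open>t\<close> and 1 in
    their order, forces collinearity.\<close>
  have xt: "x t = t *\<^sub>R e" if "t \<ge> 0" for t
  proof (cases "t \<le> 1")
    case True
    then have "norm (x t + (x 1 - x t)) = norm (x t) + norm (x 1 - x t)"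
      using iso[of 0 t] iso[of t 1] iso[of 0 1] that by (simp add: x0)
    then have "t *\<^sub>R (x 1 - x t) = (1 - t) *\<^sub>R x t"
      unfolding norm_triangle_eq using iso[of 0 t] iso[of t 1] that True by (simp add: x0)
    then show ?thesis by (simp add: e_def algebra_simps)
  next
    case False
    then have "norm (x 1 + (x t - x 1)) = norm (x 1) + norm (x t - x 1)"
      using iso[of 0 t] iso[of 1 t] iso[of 0 1] that by (simp add: x0)
    then have "x t - x 1 = (t - 1) *\<^sub>R x 1"
      unfolding norm_triangle_eq using iso[of 0 1] iso[of 1 t] that False by (simp add: x0)
    then show ?thesis by (simp add: e_def algebra_simps)
  qed
  define \<sigma> where "\<sigma> t = snd (- \<gamma> 0 \<odot> \<gamma> t)" for t
  have inc0: "- \<gamma> 0 \<odot> \<gamma> t = (t *\<^sub>R e, \<sigma> t)" if "t \<ge> 0" for t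
    using xt[OF that] by (simp add: \<sigma>_def x_def heis_mult_def prod_eq_iff)
  obtain C where C: "C > 0" "\<And>p. \<bar>snd p\<bar> \<le> C * (cc_norm p)\<^sup>2" by (rule cc_norm_area) blast
  \<comment> \<open>Both positions are multiples of \<open>e\<close>, so no cocycle term appears and
    the difference is the central coordinate of an increment of norm \<open>t - s\<close>.\<close>
  have inc: "\<bar>\<sigma> t - \<sigma> s\<bar> \<le> C * (t - s)\<^sup>2" if "0 \<le> s" "s \<le> t" for s t
  proof -
    have "- \<gamma> s \<odot> \<gamma> t = - (- \<gamma> 0 \<odot> \<gamma> s) \<odot> (- \<gamma> 0 \<odot> \<gamma> t)"
      by (simp add: heis_mult_assoc[OF bilin])
    also have "\<dots> = - (s *\<^sub>R e, \<sigma> s) \<odot> (t *\<^sub>R e, \<sigma> t)"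
      by (simp only: inc0[OF that(1)] inc0[OF order_trans[OF that]])
    finally have "snd (- \<gamma> s \<odot> \<gamma> t) = \<sigma> t - \<sigma> s"
      by (simp add: heis_mult_def form_simps)
    then show ?thesis using C(2)[of "- \<gamma> s \<odot> \<gamma> t"] ray[OF that] by simp
  qed
  have "\<sigma> 0 = 0" by (simp add: \<sigma>_def)
  then have "\<sigma> t = 0" if "t \<ge> 0" for t
    using quadratic_increments_zero[of \<sigma> C] inc C(1) that by simp
  then have "\<gamma> t = \<gamma> 0 \<odot> (t *\<^sub>R e, 0)" if "t \<ge> 0" for t
    using inc0[OF that] that mul_simps(6)[of "\<gamma> 0" "\<gamma> t"] by simp
  then show ?thesis using e by blast
qed

text \<open>From below, the norm is bounded by that of the projection. From above, two horizontal
  segments reach the same point with a deviation \<open>w\<close> that stays bounded, because the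
  central coordinate grows no faster than \<open>norm (y t)\<close>; a bounded deviation lengthens a
  path of length about \<open>t\<close> by an amount tending to 0.\<close>

lemma cc_norm_busemann:
  assumes v: "norm v = 1"
  shows "((\<lambda>t. cc_norm (- p \<odot> (t *\<^sub>R v, 0)) - t) \<longlongrightarrow> - (fst p \<bullet> v)) at_top"
proof -
  obtain x s where p: "p = (x, s)" by force
  define a where "a = x \<bullet> v"
  define y where "y t = t *\<^sub>R v - x" for t
  define \<sigma> where "\<sigma> t = - s - t * \<omega> x v / 2" for t
  have eq: "- p \<odot> (t *\<^sub>R v, 0) = (y t, \<sigma> t)" for t
    by (simp add: p heis_mult_def y_def \<sigma>_def form_simps)
  have ny: "(norm (y t))\<^sup>2 = t\<^sup>2 - 2 * a * t + (norm x)\<^sup>2" for t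
    using v unfolding y_def power2_norm_eq_inner norm_eq_1
    by (simp add: inner_diff_left inner_diff_right a_def inner_commute power2_eq_square[of t] algebra_simps)
  have lim: "((\<lambda>t::real. sqrt (t\<^sup>2 - 2 * a * t + b) - t) \<longlongrightarrow> - a) at_top" for b
    by real_asymp
  obtain m where m: "m > 0" "\<And>y \<sigma>. y \<noteq> 0 \<Longrightarrow> \<exists>z. \<omega> z y = \<sigma> \<and> m * norm y * norm z \<le> \<bar>\<sigma>\<bar>" by (rule ex_form_eq) blast
  \<comment> \<open>Bound for \<open>norm w\<close> obtained from
    \<open>m * norm (y t) * norm w \<le> \<bar>2 * \<sigma> t\<bar>\<close>, using
    \<open>norm (y t) \<ge> t / 2\<close> and, for \<open>t \<ge> 1\<close>, that the right side is
    at most \<open>t * (2 * \<bar>s\<bar> + \<bar>\<omega> x v\<bar>)\<close>.\<close>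
  define W where "W = (2 / m) * (2 * \<bar>s\<bar> + \<bar>\<omega> x v\<bar>)"
  have up: "cc_norm (y t, \<sigma> t) \<le> sqrt (t\<^sup>2 - 2 * a * t + ((norm x)\<^sup>2 + 4 * W\<^sup>2))" if t: "t \<ge> 2 * norm x + 1" for t
  proof -
    have t1: "t \<ge> 1" using t norm_ge_zero[of x] by linarith
    have yt: "norm (y t) \<ge> t / 2"
      using norm_triangle_ineq2[of "t *\<^sub>R v" x] v t t1 by (simp add: y_def)
    then have "y t \<noteq> 0" using t1 by auto
    then obtain w where w: "\<omega> w (y t) = 2 * \<sigma> t" "m * norm (y t) * norm w \<le> \<bar>2 * \<sigma> t\<bar>" using m(2) by blast
    have "m * (t / 2) * norm w \<le> m * norm (y t) * norm w" using yt m(1) by (intro mult_right_mono mult_left_mono) auto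
    also have "\<dots> \<le> 2 * \<bar>s\<bar> + t * \<bar>\<omega> x v\<bar>"
      using w(2) t1 abs_triangle_ineq4[of "- s" "t * \<omega> x v / 2"] by (simp add: \<sigma>_def abs_mult)
    also have "\<dots> \<le> t * (2 * \<bar>s\<bar> + \<bar>\<omega> x v\<bar>)"
      using mult_right_mono[OF t1, of "2 * \<bar>s\<bar>"] by (simp add: algebra_simps)
    finally have "t * (m * norm w) \<le> t * (2 * (2 * \<bar>s\<bar> + \<bar>\<omega> x v\<bar>))" by (simp add: algebra_simps)
    then have "m * norm w \<le> 2 * (2 * \<bar>s\<bar> + \<bar>\<omega> x v\<bar>)" using t1 by (subst (asm) mult_le_cancel_left_pos) auto
    then have "norm w \<le> W" using m(1) by (simp add: W_def field_simps)
    then have w2: "(norm w)\<^sup>2 \<le> W\<^sup>2" by (intro power_mono) auto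
    \<comment> \<open>The two segments add up to \<open>y t\<close>, and their cocycle term is
      \<open>\<omega> b c / 2 = \<omega> w (y t) / 2 = \<sigma> t\<close>.\<close>
    define b c where "b = (1/2) *\<^sub>R y t + w" and "c = (1/2) *\<^sub>R y t - w"
    have "(y t, \<sigma> t) = (b, 0) \<odot> (c, 0)"
      using w(1) skew[of "y t" w] by (simp add: heis_mult_def b_def c_def form_simps scaleR_add_left[symmetric])
    then have "cc_norm (y t, \<sigma> t) \<le> norm b + norm c"
      using cc_norm_mul[of "(b, 0)" "(c, 0)"] by simp
    also have "\<dots> \<le> sqrt ((norm (y t))\<^sup>2 + 4 * (norm w)\<^sup>2)"
    proof (rule real_le_rsqrt)
      have "(norm b + norm c)\<^sup>2 \<le> 2 * ((norm b)\<^sup>2 + (norm c)\<^sup>2)"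
        using sum_squares_bound[of "norm b" "norm c"] by (simp add: power2_sum)
      also have "\<dots> = (norm (y t))\<^sup>2 + 4 * (norm w)\<^sup>2"
        by (simp add: b_def c_def power2_norm_eq_inner inner_add_left inner_add_right inner_diff_left inner_diff_right inner_commute)
      finally show "(norm b + norm c)\<^sup>2 \<le> (norm (y t))\<^sup>2 + 4 * (norm w)\<^sup>2" .
    qed
    also have "\<dots> \<le> sqrt (t\<^sup>2 - 2 * a * t + ((norm x)\<^sup>2 + 4 * W\<^sup>2))"
      using w2 by (simp add: ny)
    finally show ?thesis .
  qed
  have low: "sqrt (t\<^sup>2 - 2 * a * t + (norm x)\<^sup>2) \<le> cc_norm (y t, \<sigma> t)" for t
    using cc_norm_ge[of "(y t, \<sigma> t)"] by (simp add: ny[symmetric])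
  have "((\<lambda>t. cc_norm (y t, \<sigma> t) - t) \<longlongrightarrow> - a) at_top"
  proof (rule tendsto_sandwich[OF _ _ lim[of "(norm x)\<^sup>2"] lim[of "(norm x)\<^sup>2 + 4 * W\<^sup>2"]])
    show "\<forall>\<^sub>F t in at_top. cc_norm (y t, \<sigma> t) - t \<le> sqrt (t\<^sup>2 - 2 * a * t + ((norm x)\<^sup>2 + 4 * W\<^sup>2)) - t"
      using eventually_ge_at_top[of "2 * norm x + 1"] by eventually_elim (use up in simp)
  qed (use low in simp)
  then show ?thesis unfolding eq by (simp add: p a_def)
qed

end

section \<open>From isometries to linear similarities\<close>

lemma inner_preserving_imp_linear:
  fixes f :: "'v::real_inner \<Rightarrow> 'v"
  assumes f: "\<And>v w. f v \<bullet> f w = v \<bullet> w"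
  shows "linear f"
proof (rule linearI)
  fix x y c
  have "(f (x + y) - f x - f y) \<bullet> (f (x + y) - f x - f y) = (x + y - x - y) \<bullet> (x + y - x - y)"
    unfolding inner_diff_left inner_diff_right f ..
  then show "f (x + y) = f x + f y" by (simp add: diff_diff_eq)
  have "(f (c *\<^sub>R x) - c *\<^sub>R f x) \<bullet> (f (c *\<^sub>R x) - c *\<^sub>R f x) = (c *\<^sub>R x - c *\<^sub>R x) \<bullet> (c *\<^sub>R x - c *\<^sub>R x)"
    unfolding inner_diff_left inner_diff_right inner_scaleR_left inner_scaleR_right f
    by (simp add: algebra_simps)
  then show "f (c *\<^sub>R x) = c *\<^sub>R f x" by simp
qed

lemma isometry_fixing_0_similar:
  fixes \<omega>1 \<omega>2 :: "'v::euclidean_space \<Rightarrow> 'v \<Rightarrow> real"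
  assumes \<omega>1: "symplectic_form \<omega>1" and \<omega>2: "symplectic_form \<omega>2"
    and F0: "F 0 = 0" and F: "\<And>p q. cc_dist \<omega>2 (\<bullet>) (F p) (F q) = cc_dist \<omega>1 (\<bullet>) p q"
  shows "heis_similar \<omega>2 (\<bullet>) \<omega>1 (\<bullet>)"
proof -
  interpret H1: heisenberg \<omega>1 by (rule heisenberg.intro[OF \<omega>1])
  interpret H2: heisenberg \<omega>2 by (rule heisenberg.intro[OF \<omega>2])
  have iso: "H2.cc_norm (H2.mul (- F p) (F q)) = H1.cc_norm (H1.mul (- p) q)" for p q
    using F[of p q] by (simp add: H1.cc_dist_eq_cc_norm H2.cc_dist_eq_cc_norm)
  \<comment> \<open>The direction \<open>e\<close> may still depend on the base point
    \<open>p\<close>; this is excluded only by \<open>hor\<close>.\<close>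
  have lines: "\<exists>e. norm e = 1 \<and> (\<forall>t\<ge>0. F (H1.mul p (t *\<^sub>R u, 0)) = H2.mul (F p) (t *\<^sub>R e, 0))"
    if u: "norm u = 1" for p u
  proof -
    define \<gamma> where "\<gamma> t = F (H1.mul p (t *\<^sub>R u, 0))" for t
    have "H2.cc_norm (H2.mul (- \<gamma> s) (\<gamma> t)) = t - s" if "0 \<le> s" "s \<le> t" for s t
    proof -
      have "H1.mul (- H1.mul p (s *\<^sub>R u, 0)) (H1.mul p (t *\<^sub>R u, 0)) = H1.mul (- (s *\<^sub>R u, 0)) (t *\<^sub>R u, 0)"
        by (simp add: heis_mult_assoc[OF H1.bilin])
      also have "\<dots> = ((t - s) *\<^sub>R u, 0)" by (simp add: heis_mult_def H1.form_simps scaleR_diff_left)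
      finally show ?thesis using u that by (simp add: \<gamma>_def iso del: H1.mul_simps(7))
    qed
    from H2.ray_horizontal[of \<gamma>, OF this] show ?thesis by (simp add: \<gamma>_def zero_prod_def[symmetric])
  qed
  define f where "f v = fst (F (v, 0))" for v
  have unit: "norm (f u) = 1 \<and> (\<forall>t\<ge>0. F (t *\<^sub>R u, 0) = (t *\<^sub>R f u, 0))" if u: "norm u = 1" for u
  proof -
    obtain e where e: "norm e = 1" "\<And>t. t \<ge> 0 \<Longrightarrow> F (t *\<^sub>R u, 0) = (t *\<^sub>R e, 0)"
      using lines[OF u, of 0] F0 by auto
    then have "f u = e" using e(2)[of 1] by (simp add: f_def)
    then show ?thesis using e by simp
  qed
  have polar: "\<exists>u t. norm u = 1 \<and> t \<ge> 0 \<and> v = t *\<^sub>R u" for v :: 'v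
  proof (cases "v = 0")
    case True
    obtain u :: 'v where "norm u = 1" using vector_choose_size[of 1] by auto
    then show ?thesis using True by (intro exI[of _ u] exI[of _ 0]) simp
  next
    case False
    then show ?thesis by (intro exI[of _ "v /\<^sub>R norm v"] exI[of _ "norm v"]) simp
  qed
  have f_polar: "f (t *\<^sub>R u) = t *\<^sub>R f u" if "norm u = 1" "t \<ge> 0" for u t
    using unit[OF that(1)] that(2) by (simp add: f_def)
  have busemann: "fst (F p) \<bullet> f u = fst p \<bullet> u" if u: "norm u = 1" for p u
  proof -
    have "\<forall>\<^sub>F t in at_top. H1.cc_norm (H1.mul (- p) (t *\<^sub>R u, 0)) - t = H2.cc_norm (H2.mul (- F p) (t *\<^sub>R f u, 0)) - t"
      using eventually_ge_at_top[of 0]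
      by eventually_elim (use unit[OF u] iso[of p] in \<open>metis\<close>)
    then have "((\<lambda>t. H2.cc_norm (H2.mul (- F p) (t *\<^sub>R f u, 0)) - t) \<longlongrightarrow> - (fst p \<bullet> u)) at_top"
      using H1.cc_norm_busemann[OF u, of p] by (rule Lim_transform_eventually[rotated])
    moreover have "((\<lambda>t. H2.cc_norm (H2.mul (- F p) (t *\<^sub>R f u, 0)) - t) \<longlongrightarrow> - (fst (F p) \<bullet> f u)) at_top"
      using H2.cc_norm_busemann[of "f u" "F p"] unit[OF u] by blast
    ultimately have "- (fst p \<bullet> u) = - (fst (F p) \<bullet> f u)" by (intro tendsto_unique) auto
    then show ?thesis by simp
  qed
  have busemann': "fst (F p) \<bullet> f w = fst p \<bullet> w" for p w
  proof -
    obtain u t where "norm u = 1" "t \<ge> 0" "w = t *\<^sub>R u" using polar by blast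
    then show ?thesis using busemann[of u p] f_polar[of u t] by simp
  qed
  have f_inner: "f v \<bullet> f w = v \<bullet> w" for v w
    using busemann'[of "(v, 0)" w] by (simp add: f_def[of v])
  have lin: "linear f" by (rule inner_preserving_imp_linear[OF f_inner])
  have bij: "bij f"
    using f_inner by (intro linear_inj_imp_bij[OF lin]) (metis inner_eq_zero_iff)
  \<comment> \<open>As \<open>f\<close> is onto, the inner products with all \<open>f w\<close>
    determine a vector, so \<open>busemann'\<close> determines the projection of
    \<open>F p\<close>.\<close>
  have proj: "fst (F p) = f (fst p)" for p
  proof -
    obtain w where w: "fst (F p) - f (fst p) = f w" using bij by (metis bij_pointE)
    then have "f w \<bullet> f w = fst (F p) \<bullet> f w - f (fst p) \<bullet> f w" by (metis inner_diff_left)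
    then have "f w = 0" by (simp add: busemann' f_inner linear_0[OF lin])
    then show ?thesis using w by simp
  qed
  \<comment> \<open>Comparing projections at both ends of the segment identifies its image
    direction, whatever the base point.\<close>
  have hor: "F (H1.mul p (v, 0)) = H2.mul (F p) (f v, 0)" for p v
  proof -
    obtain u t where v: "norm u = 1" "t \<ge> 0" "v = t *\<^sub>R u" using polar by blast
    obtain e where e: "F (H1.mul p (v, 0)) = H2.mul (F p) (t *\<^sub>R e, 0)" using lines[OF v(1), of p] v by blast
    then have "f (fst p + v) = f (fst p) + t *\<^sub>R e" using proj[of "H1.mul p (v, 0)"] proj[of p] by (simp add: heis_mult_def)
    then have "f v = t *\<^sub>R e" by (simp add: linear_add[OF lin])
    then show ?thesis using e by simp
  qed
  \<comment> \<open>\<open>F\<close> is only known to respect right translations by horizontal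
    elements, but a commutator is built from four of them.\<close>
  have comm: "F (0, \<omega>1 v w) = (0, \<omega>2 (f v) (f w))" for v w
  proof -
    have "F (v, 0) = (f v, 0)" using hor[of 0 v] F0 by simp
    then have "F (H1.mul (H1.mul (H1.mul (v, 0) (w, 0)) (- v, 0)) (- w, 0))
      = H2.mul (H2.mul (H2.mul (f v, 0) (f w, 0)) (- f v, 0)) (- f w, 0)"
      by (simp only: hor linear_neg[OF lin])
    then show ?thesis by (simp only: H1.commutator H2.commutator)
  qed
  obtain a b where ab: "\<omega>1 a b = 1" by (rule H1.ex_unit_pair)
  define \<mu> where "\<mu> = \<omega>2 (f a) (f b)"
  have form: "\<omega>2 (f v) (f w) = \<mu> * \<omega>1 v w" for v w
  proof -
    \<comment> \<open>The value of \<open>F\<close> at a central point depends only on the number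
      \<open>\<omega>1 v w\<close>. Replacing the pair by a multiple of \<open>a\<close> together
      with \<open>b\<close>, with the same number, makes this dependence linear.\<close>
    have "\<omega>1 (\<omega>1 v w *\<^sub>R a) b = \<omega>1 v w" by (simp add: H1.form_simps ab)
    then have "F (0, \<omega>1 (\<omega>1 v w *\<^sub>R a) b) = F (0, \<omega>1 v w)" by simp
    then show ?thesis unfolding comm by (simp add: linear_cmul[OF lin] H2.form_simps \<mu>_def mult.commute)
  qed
  have "\<mu> \<noteq> 0"
  proof
    assume "\<mu> = 0"
    then have "\<omega>2 (f a) w = 0" for w using form[of a] bij by (metis bij_pointE mult_zero_left)
    then have "f a = 0" by (rule symplectic_form_nondegenerate[OF \<omega>2])
    then have "a = 0" using lin bij by (metis bij_is_inj linear_injective_0)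
    then show False using ab by (simp add: H1.form_simps)
  qed
  then show ?thesis
    unfolding heis_similar_def using lin bij f_inner form
    by (intro exI[of _ f] exI[of _ \<mu>] exI[of _ 1]) simp
qed

lemma isometry_similar_inner:
  fixes \<omega>1 \<omega>2 :: "'v::euclidean_space \<Rightarrow> 'v \<Rightarrow> real"
  assumes \<omega>1: "symplectic_form \<omega>1" and \<omega>2: "symplectic_form \<omega>2"
    and F: "\<And>p q. cc_dist \<omega>2 (\<bullet>) (F p) (F q) = cc_dist \<omega>1 (\<bullet>) p q"
  shows "heis_similar \<omega>2 (\<bullet>) \<omega>1 (\<bullet>)"
proof (rule isometry_fixing_0_similar[OF \<omega>1 \<omega>2, where F = "\<lambda>p. heis_mult \<omega>2 (- F 0) (F p)"])
  interpret H2: heisenberg \<omega>2 by (rule heisenberg.intro[OF \<omega>2])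
  show "heis_mult \<omega>2 (- F 0) (F 0) = 0" by simp
  show "cc_dist \<omega>2 (\<bullet>) (heis_mult \<omega>2 (- F 0) (F p)) (heis_mult \<omega>2 (- F 0) (F q)) = cc_dist \<omega>1 (\<bullet>) p q" for p q
    unfolding F[of p q, symmetric] H2.cc_dist_eq_cc_norm by (simp add: heis_mult_assoc[OF H2.bilin])
qed

theorem heis_isometric_iff_similar:
  fixes \<omega>1 \<omega>2 g1 g2 :: "'v::euclidean_space \<Rightarrow> 'v \<Rightarrow> real"
  assumes \<omega>1: "symplectic_form \<omega>1" and \<omega>2: "symplectic_form \<omega>2"
    and g1: "scalar_product g1" and g2: "scalar_product g2"
  shows "heis_isometric \<omega>1 g1 \<omega>2 g2 \<longleftrightarrow> heis_similar \<omega>1 g1 \<omega>2 g2"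
proof
  assume "heis_isometric \<omega>1 g1 \<omega>2 g2"
  then obtain F where F: "\<And>p q. cc_dist \<omega>2 g2 (F p) (F q) = cc_dist \<omega>1 g1 p q"
    unfolding heis_isometric_def by blast
  obtain T1 :: "'v \<Rightarrow> 'v" where T1: "linear T1" "bij T1" "\<And>v w. g1 (T1 v) (T1 w) = v \<bullet> w"
    using scalar_product_frame[OF g1] by metis
  obtain T2 :: "'v \<Rightarrow> 'v" where T2: "linear T2" "bij T2" "\<And>v w. g2 (T2 v) (T2 w) = v \<bullet> w"
    using scalar_product_frame[OF g2] by metis
  let ?\<omega>1 = "\<lambda>v w. \<omega>1 (T1 v) (T1 w)" and ?\<omega>2 = "\<lambda>v w. \<omega>2 (T2 v) (T2 w)"
  \<comment> \<open>\<open>F\<close> read in orthonormal frames on both sides, with the central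
    coordinate unchanged; hence the factors 1 below.\<close>
  define G where "G p = (inv T2 (fst (F (T1 (fst p), snd p))), snd (F (T1 (fst p), snd p)))" for p
  have T2G: "(T2 (fst (G p)), 1 * snd (G p)) = F (T1 (fst p), 1 * snd p)" for p
    using T2(2) by (simp add: G_def bij_is_surj surj_f_inv_f)
  have "cc_dist ?\<omega>2 (\<bullet>) (G p) (G q) = cc_dist ?\<omega>1 (\<bullet>) p q" for p q
  proof -
    have "cc_dist ?\<omega>2 (\<bullet>) (G p) (G q) = cc_dist \<omega>2 g2 (T2 (fst (G p)), 1 * snd (G p)) (T2 (fst (G q)), 1 * snd (G q))"
      by (rule cc_dist_similar[symmetric]) (use T2 in auto)
    also have "\<dots> = cc_dist \<omega>1 g1 (T1 (fst p), 1 * snd p) (T1 (fst q), 1 * snd q)"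
      by (simp only: T2G F)
    also have "\<dots> = cc_dist ?\<omega>1 (\<bullet>) p q"
      by (rule cc_dist_similar) (use T1 in auto)
    finally show ?thesis .
  qed
  then have "heis_similar ?\<omega>2 (\<bullet>) ?\<omega>1 (\<bullet>)"
    by (rule isometry_similar_inner[OF symplectic_form_pullback[OF \<omega>1 T1(1,2)] symplectic_form_pullback[OF \<omega>2 T2(1,2)]])
  then have "heis_similar ?\<omega>1 (\<bullet>) ?\<omega>2 (\<bullet>)" by (rule heis_similar_sym)
  then show "heis_similar \<omega>1 g1 \<omega>2 g2"
    using heis_similar_pullback[OF T1, of \<omega>1] heis_similar_pullback[OF T2, of \<omega>2] heis_similar_trans heis_similar_sym
    by blast
next
  assume "heis_similar \<omega>1 g1 \<omega>2 g2"
  then have "heis_similar \<omega>2 g2 \<omega>1 g1" by (rule heis_similar_sym)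
  then obtain L \<mu> c where L: "linear L" "bij L" "\<mu> \<noteq> 0" "c > 0" "\<And>v w. g2 (L v) (L w) = c * g1 v w"
    "\<And>v w. \<omega>2 (L v) (L w) = \<mu> * \<omega>1 v w"
    unfolding heis_similar_def by auto
  \<comment> \<open>The dilation that makes the similarity isometric on \<open>V\<close>; on the
    centre it acts by the square of \<open>1 / sqrt c\<close>.\<close>
  define M where "M v = (1 / sqrt c) *\<^sub>R L v" for v
  define F where "F p = (M (fst p), \<mu> / c * snd p)" for p
  have M: "linear M" unfolding M_def by (intro linear_compose_scale_right L)
  have gM: "g2 (M v) (M w) = g1 v w" and \<omega>M: "\<omega>2 (M v) (M w) = \<mu> / c * \<omega>1 v w" for v w
    using L by (simp_all add: M_def bilinear_simps[OF scalar_product_bilinear[OF g2]] bilinear_simps[OF symplectic_form_bilinear[OF \<omega>2]])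
  have bM: "bij M"
    using similarity_bij[OF M g1, of 1 g2] gM scalar_product_bilinear[OF g2] by simp
  have "cc_dist \<omega>2 g2 (F p) (F q) = cc_dist \<omega>1 g1 p q" for p q
    unfolding F_def by (rule cc_dist_similar[OF M bM]) (use gM \<omega>M L in auto)
  moreover have "bij F"
  proof (rule bij_betw_byWitness[where f' = "\<lambda>q. (inv M (fst q), c / \<mu> * snd q)"])
    show "\<forall>p\<in>UNIV. (inv M (fst (F p)), c / \<mu> * snd (F p)) = p"
      using L bM by (simp add: F_def bij_is_inj)
    show "\<forall>q\<in>UNIV. F (inv M (fst q), c / \<mu> * snd q) = q"
      using L bM by (simp add: F_def bij_is_surj surj_f_inv_f)
  qed auto
  ultimately show "heis_isometric \<omega>1 g1 \<omega>2 g2" unfolding heis_isometric_def by blast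
qed

subsection \<open>Sub-Laplacians\<close>

lemma second_difference_quotient:
  fixes \<psi> :: "'a::real_normed_vector \<Rightarrow> real"
  assumes \<psi>: "\<And>q. (\<psi> has_derivative \<psi>' q) (at q)" and A: "((\<lambda>q. \<psi>' q v) has_derivative A) (at a)" and "e > 0"
  shows "\<exists>\<delta>>0. \<forall>h. 0 < h \<and> h < \<delta> \<longrightarrow>
    \<bar>\<psi> (a + h *\<^sub>R v + h *\<^sub>R w) - \<psi> (a + h *\<^sub>R v) - \<psi> (a + h *\<^sub>R w) + \<psi> a - h\<^sup>2 * A w\<bar> \<le> e * h\<^sup>2"
proof -
  \<comment> \<open>Chosen so that \<open>h * m\<close> bounds both displacements from
    \<open>a\<close> at which the derivative is compared; the summand 1 keeps it positive.\<close>
  define m where "m = norm v + norm w + 1"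
  have m: "m > 0" by (simp add: m_def add_nonneg_pos)
  have linA: "bounded_linear A" using A by (rule has_derivative_bounded_linear)
  obtain d where d: "d > 0" "\<And>y. norm (y - a) < d \<Longrightarrow> norm (\<psi>' y v - \<psi>' a v - A (y - a)) \<le> (e / (2 * m)) * norm (y - a)"
    using A \<open>e > 0\<close> m unfolding has_derivative_at_alt by (metis divide_pos_pos mult_pos_pos zero_less_numeral)
  have "\<bar>\<psi> (a + h *\<^sub>R v + h *\<^sub>R w) - \<psi> (a + h *\<^sub>R v) - \<psi> (a + h *\<^sub>R w) + \<psi> a - h\<^sup>2 * A w\<bar> \<le> e * h\<^sup>2"
    if h: "0 < h" "h < d / m" for h
  proof -
    \<comment> \<open>The second difference is \<open>\<phi> h - \<phi> 0\<close>. The mean value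
      theorem turns it into a difference of first derivatives in the direction \<open>v\<close>,
      each approximated through \<open>A\<close>.\<close>
    define \<phi> where "\<phi> s = \<psi> (a + h *\<^sub>R w + s *\<^sub>R v) - \<psi> (a + s *\<^sub>R v)" for s
    have line: "((\<lambda>s. \<psi> (b + s *\<^sub>R v)) has_field_derivative \<psi>' (b + s *\<^sub>R v) v) (at s)" for b s
    proof -
      have "((\<lambda>s. b + s *\<^sub>R v) has_derivative (\<lambda>r. r *\<^sub>R v)) (at s)" by (auto intro!: derivative_eq_intros)
      from has_derivative_compose[OF this \<psi>]
      have "((\<lambda>s. \<psi> (b + s *\<^sub>R v)) has_derivative (\<lambda>r. \<psi>' (b + s *\<^sub>R v) (r *\<^sub>R v))) (at s)" .
      then show ?thesis
        using linear_cmul[OF bounded_linear.linear[OF has_derivative_bounded_linear[OF \<psi>]]]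
        by (simp add: has_field_derivative_def mult.commute[of "\<psi>' _ _"] mult_commute_abs)
    qed
    have "\<exists>\<xi>. 0 < \<xi> \<and> \<xi> < h \<and> \<phi> h - \<phi> 0 = (h - 0) * (\<psi>' (a + h *\<^sub>R w + \<xi> *\<^sub>R v) v - \<psi>' (a + \<xi> *\<^sub>R v) v)"
      unfolding \<phi>_def by (rule MVT2[OF h(1)]) (intro DERIV_diff line)
    then obtain \<xi> where \<xi>: "0 < \<xi>" "\<xi> < h"
      "\<phi> h - \<phi> 0 = h * (\<psi>' (a + h *\<^sub>R w + \<xi> *\<^sub>R v) v - \<psi>' (a + \<xi> *\<^sub>R v) v)" by auto
    have est: "\<bar>\<psi>' (a + y) v - \<psi>' a v - A y\<bar> \<le> e / 2 * h" if y: "norm y \<le> h * m" for y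
    proof -
      have "norm (a + y - a) < d" using y h m by (simp add: field_simps)
      from d(2)[OF this] have "\<bar>\<psi>' (a + y) v - \<psi>' a v - A y\<bar> \<le> (e / (2 * m)) * norm y" by simp
      also have "\<dots> \<le> (e / (2 * m)) * (h * m)" using y \<open>e > 0\<close> m by (intro mult_left_mono) auto
      finally show ?thesis using m by simp
    qed
    have "\<xi> * norm v \<le> h * norm v" using \<xi> by (intro mult_right_mono) auto
    then have "norm (\<xi> *\<^sub>R v) \<le> h * m" "norm (h *\<^sub>R w + \<xi> *\<^sub>R v) \<le> h * m"
    proof -
      have "norm (\<xi> *\<^sub>R v) = \<xi> * norm v" "norm (h *\<^sub>R w) = h * norm w" "h * norm w \<ge> 0"
        using \<xi> h by simp_all
      moreover have "h * m = h * norm v + h * norm w + h" by (simp add: m_def algebra_simps)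
      ultimately show "norm (\<xi> *\<^sub>R v) \<le> h * m" "norm (h *\<^sub>R w + \<xi> *\<^sub>R v) \<le> h * m"
        using \<open>\<xi> * norm v \<le> h * norm v\<close> h norm_triangle_ineq[of "h *\<^sub>R w" "\<xi> *\<^sub>R v"] by linarith+
    qed
    note est' = est[OF this(1)] est[OF this(2)]
    have "A (h *\<^sub>R w + \<xi> *\<^sub>R v) = h * A w + A (\<xi> *\<^sub>R v)"
      using bounded_linear.linear[OF linA] by (simp add: linear_add linear_cmul)
    then have "\<bar>\<psi>' (a + h *\<^sub>R w + \<xi> *\<^sub>R v) v - \<psi>' (a + \<xi> *\<^sub>R v) v - h * A w\<bar> \<le> e * h"
      using est' unfolding add.assoc[symmetric] by linarith
    then have "h * \<bar>\<psi>' (a + h *\<^sub>R w + \<xi> *\<^sub>R v) v - \<psi>' (a + \<xi> *\<^sub>R v) v - h * A w\<bar> \<le> h * (e * h)"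
      using h by (intro mult_left_mono) auto
    then have "\<bar>h * (\<psi>' (a + h *\<^sub>R w + \<xi> *\<^sub>R v) v - \<psi>' (a + \<xi> *\<^sub>R v) v - h * A w)\<bar> \<le> h * (e * h)"
      using h by (simp add: abs_mult)
    moreover have "h * (\<psi>' (a + h *\<^sub>R w + \<xi> *\<^sub>R v) v - \<psi>' (a + \<xi> *\<^sub>R v) v - h * A w) =
      \<psi> (a + h *\<^sub>R v + h *\<^sub>R w) - \<psi> (a + h *\<^sub>R v) - \<psi> (a + h *\<^sub>R w) + \<psi> a - h\<^sup>2 * A w"
      unfolding right_diff_distrib[of h _ "h * A w"] \<xi>(3)[symmetric] by (simp add: \<phi>_def power2_eq_square algebra_simps)
    ultimately show ?thesis by (simp add: power2_eq_square mult_ac)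
  qed
  moreover have "d / m > 0" using d m by simp
  ultimately show ?thesis by blast
qed

text \<open>The second difference is symmetric in the two directions and, divided by
  \<open>h\<^sup>2\<close>, approximates both mixed derivatives.\<close>

lemma second_derivative_symmetric:
  fixes \<psi> :: "'a::real_normed_vector \<Rightarrow> real"
  assumes \<psi>: "\<And>q. (\<psi> has_derivative \<psi>' q) (at q)"
    and A: "((\<lambda>q. \<psi>' q v) has_derivative A) (at a)" and B: "((\<lambda>q. \<psi>' q w) has_derivative B) (at a)"
  shows "A w = B v"
proof (rule ccontr)
  assume "A w \<noteq> B v"
  \<comment> \<open>A third of the gap, so that two approximation errors cannot fill it.\<close>
  define e where "e = \<bar>A w - B v\<bar> / 3"
  have e: "e > 0" using \<open>A w \<noteq> B v\<close> by (simp add: e_def)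
  let ?D = "\<lambda>h. \<psi> (a + h *\<^sub>R v + h *\<^sub>R w) - \<psi> (a + h *\<^sub>R v) - \<psi> (a + h *\<^sub>R w) + \<psi> a"
  obtain d where d: "d > 0" "\<And>h. 0 < h \<Longrightarrow> h < d \<Longrightarrow> \<bar>?D h - h\<^sup>2 * A w\<bar> \<le> e * h\<^sup>2"
    using second_difference_quotient[OF \<psi> A e, of w] by blast
  obtain d' where d': "d' > 0" "\<And>h. 0 < h \<Longrightarrow> h < d' \<Longrightarrow>
      \<bar>\<psi> (a + h *\<^sub>R w + h *\<^sub>R v) - \<psi> (a + h *\<^sub>R w) - \<psi> (a + h *\<^sub>R v) + \<psi> a - h\<^sup>2 * B v\<bar> \<le> e * h\<^sup>2"
    using second_difference_quotient[OF \<psi> B e, of v] by blast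
  define h where "h = min d d' / 2"
  have h: "0 < h" "h < d" "h < d'" using d(1) d'(1) by (auto simp: h_def)
  have sw: "a + h *\<^sub>R w + h *\<^sub>R v = a + h *\<^sub>R v + h *\<^sub>R w" by (simp add: algebra_simps)
  have "\<bar>h\<^sup>2 * A w - h\<^sup>2 * B v\<bar> \<le> 2 * (e * h\<^sup>2)"
    using d(2)[OF h(1,2)] d'(2)[OF h(1,3)] unfolding sw by linarith
  then have "h\<^sup>2 * \<bar>A w - B v\<bar> \<le> h\<^sup>2 * (2 * e)"
    unfolding right_diff_distrib[symmetric] abs_mult by (simp add: mult_ac)
  then have "\<bar>A w - B v\<bar> \<le> 2 * e" using h(1) by simp
  then show False using e by (simp add: e_def)
qed

section \<open>Orthonormal expansions and traces\<close>

lemma g_orthonormal_basis_expansion: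
  assumes g: "scalar_product g" and B: "g_orthonormal_basis g B"
  shows "v = (\<Sum>X\<in>B. g v X *\<^sub>R X)" "g v w = (\<Sum>X\<in>B. g v X * g w X)"
proof -
  obtain T :: "'a \<Rightarrow> 'a" where T: "linear T" "bij T" "\<And>v w. g (T v) (T w) = v \<bullet> w" "bij_betw T Basis B"
    using g_orthonormal_basis_frame[OF g B] by metis
  have eq: "v = (\<Sum>X\<in>B. g v X *\<^sub>R X)" for v
  proof -
    obtain x where x: "v = T x" using T(2) by (metis bij_pointE)
    have "(\<Sum>X\<in>B. g v X *\<^sub>R X) = (\<Sum>b\<in>Basis. (x \<bullet> b) *\<^sub>R T b)"
      using sum.reindex_bij_betw[OF T(4), of "\<lambda>X. g v X *\<^sub>R X"] by (simp add: x T(3))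
    also have "\<dots> = T (\<Sum>b\<in>Basis. (x \<bullet> b) *\<^sub>R b)" by (simp add: linear_sum[OF T(1)] linear_cmul[OF T(1)])
    finally show ?thesis by (simp add: x euclidean_representation)
  qed
  show "v = (\<Sum>X\<in>B. g v X *\<^sub>R X)" by (rule eq)
  have "g v w = g v (\<Sum>X\<in>B. g w X *\<^sub>R X)" using eq[of w] by simp
  then show "g v w = (\<Sum>X\<in>B. g v X * g w X)"
    by (simp add: bilinear_sum_right[OF scalar_product_bilinear[OF g]] bilinear_simps[OF scalar_product_bilinear[OF g]] mult.commute)
qed

text \<open>The sub-Laplacian picks an arbitrary orthonormal basis. A linear isometry carries the
  basis picked for one scalar product to an orthonormal basis for the other, which need not be the
  one picked there.\<close>

lemma g_trace_basis_independent:
  fixes \<beta> :: "'v::euclidean_space \<Rightarrow> 'v \<Rightarrow> real"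
  assumes g: "scalar_product g" and B: "g_orthonormal_basis g B" and B': "g_orthonormal_basis g B'" and \<beta>: "bilinear \<beta>"
  shows "(\<Sum>Y\<in>B'. \<beta> Y Y) = (\<Sum>X\<in>B. \<beta> X X)"
proof -
  have on: "finite B" "\<And>x y. x \<in> B \<Longrightarrow> y \<in> B \<Longrightarrow> g x y = (if x = y then 1 else 0)"
    using B by (auto simp: g_orthonormal_basis_def)
  have "\<beta> Y Y = (\<Sum>X\<in>B. \<Sum>Z\<in>B. g Y X * g Y Z * \<beta> X Z)" for Y
  proof -
    have "\<beta> Y Y = \<beta> (\<Sum>X\<in>B. g Y X *\<^sub>R X) (\<Sum>X\<in>B. g Y X *\<^sub>R X)"
      using g_orthonormal_basis_expansion(1)[OF g B, of Y] by simp
    also have "\<dots> = (\<Sum>X\<in>B. \<beta> (g Y X *\<^sub>R X) (\<Sum>Z\<in>B. g Y Z *\<^sub>R Z))"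
      by (rule bilinear_sum_left[OF \<beta>])
    finally show ?thesis
      by (simp add: bilinear_sum_right[OF \<beta>] bilinear_simps[OF \<beta>] mult.assoc mult.left_commute)
  qed
  then have "(\<Sum>Y\<in>B'. \<beta> Y Y) = (\<Sum>Y\<in>B'. \<Sum>X\<in>B. \<Sum>Z\<in>B. g Y X * g Y Z * \<beta> X Z)" by simp
  also have "\<dots> = (\<Sum>X\<in>B. \<Sum>Z\<in>B. (\<Sum>Y\<in>B'. g X Y * g Z Y) * \<beta> X Z)"
    unfolding sum_distrib_right
    by (subst sum.swap, rule sum.cong[OF refl], subst sum.swap) (simp add: scalar_product_sym[OF g])
  also have "\<dots> = (\<Sum>X\<in>B. \<Sum>Z\<in>B. g X Z * \<beta> X Z)"
    by (simp only: g_orthonormal_basis_expansion(2)[OF g B', symmetric])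
  also have "\<dots> = (\<Sum>X\<in>B. \<Sum>Z\<in>B. if X = Z then \<beta> X Z else 0)"
    using on by (intro sum.cong) auto
  also have "\<dots> = (\<Sum>X\<in>B. \<beta> X X)" using on(1) by simp
  finally show ?thesis .
qed

text \<open>Value at \<open>p\<close> of the left-invariant field of \<open>v\<close>; its integral curves are straight lines in \<open>V \<times> \<real>\<close>.\<close>
definition left_inv :: "('v::euclidean_space \<Rightarrow> 'v \<Rightarrow> real) \<Rightarrow> 'v \<times> real \<Rightarrow> 'v \<Rightarrow> 'v \<times> real" where
  "left_inv \<omega> p v = (v, \<omega> (fst p) v / 2)"

lemma left_inv_linear: "bilinear \<omega> \<Longrightarrow> linear (left_inv \<omega> p)"
  by (rule linearI) (simp_all add: left_inv_def bilinear_simps add_divide_distrib)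

lemma left_inv_constant_along:
  assumes "symplectic_form \<omega>"
  shows "left_inv \<omega> (p + t *\<^sub>R left_inv \<omega> p v) v = left_inv \<omega> p v"
  by (simp add: left_inv_def bilinear_simps[OF symplectic_form_bilinear[OF assms]] symplectic_form_self[OF assms])

lemma deriv_along_line:
  fixes u :: "'a::real_normed_vector \<Rightarrow> real"
  assumes "(u has_derivative D) (at p)"
  shows "deriv (\<lambda>t. u (p + t *\<^sub>R a)) 0 = D a"
proof -
  have "((\<lambda>t. p + t *\<^sub>R a) has_derivative (\<lambda>r. r *\<^sub>R a)) (at 0)" by (auto intro!: derivative_eq_intros)
  then have "((\<lambda>t. u (p + t *\<^sub>R a)) has_derivative (\<lambda>r. D (r *\<^sub>R a))) (at 0)"
    using has_derivative_compose[of "\<lambda>t. p + t *\<^sub>R a" _ 0 UNIV u D] assms by simp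
  then have "((\<lambda>t. u (p + t *\<^sub>R a)) has_field_derivative D a) (at 0)"
    using linear_cmul[OF bounded_linear.linear[OF has_derivative_bounded_linear[OF assms]]]
    by (simp add: has_field_derivative_def mult_commute_abs)
  then show ?thesis by (rule DERIV_imp_deriv)
qed

lemma lie_field_eq:
  assumes "symplectic_form \<omega>" "(u has_derivative D) (at p)"
  shows "lie_field \<omega> v u p = D (left_inv \<omega> p v)"
proof -
  have "heis_mult \<omega> p (t *\<^sub>R v, 0) = p + t *\<^sub>R left_inv \<omega> p v" for t
    by (simp add: heis_mult_def left_inv_def prod_eq_iff bilinear_simps[OF symplectic_form_bilinear[OF assms(1)]])
  then show ?thesis using deriv_along_line[OF assms(2)] by (simp add: lie_field_def)
qed

text \<open>The field is constant along its integral lines, so the second Lie derivative is a second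
  derivative in a fixed direction, without a first-order term.\<close>

lemma lie_field_lie_field_eq:
  assumes \<omega>: "symplectic_form \<omega>" and u: "\<And>q. (u has_derivative u' q) (at q)"
    and D: "((\<lambda>q. u' q (left_inv \<omega> p v)) has_derivative D) (at p)"
  shows "lie_field \<omega> v (lie_field \<omega> v u) p = D (left_inv \<omega> p v)"
proof -
  have line: "heis_mult \<omega> p (t *\<^sub>R v, 0) = p + t *\<^sub>R left_inv \<omega> p v" for t
    by (simp add: heis_mult_def left_inv_def prod_eq_iff bilinear_simps[OF symplectic_form_bilinear[OF \<omega>]])
  have "lie_field \<omega> v u (heis_mult \<omega> p (t *\<^sub>R v, 0)) = u' (p + t *\<^sub>R left_inv \<omega> p v) (left_inv \<omega> p v)" for t
    by (simp add: lie_field_eq[OF \<omega> u] line left_inv_constant_along[OF \<omega>])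
  then show ?thesis using deriv_along_line[OF D] by (simp add: lie_field_def[of _ _ "lie_field \<omega> v u"])
qed

definition some_basis :: "('v::euclidean_space \<Rightarrow> 'v \<Rightarrow> real) \<Rightarrow> 'v set" where
  "some_basis g = (SOME B. g_orthonormal_basis g B)"

lemma some_basis: "scalar_product g \<Longrightarrow> g_orthonormal_basis g (some_basis g)"
  unfolding some_basis_def using ex_g_orthonormal_basis by (rule someI_ex)

lemma sub_laplacian_eq:
  assumes "symplectic_form \<omega>" and "\<And>q. (u has_derivative u' q) (at q)"
    and "\<And>a. ((\<lambda>q. u' q a) has_derivative D a) (at p)"
  shows "sub_laplacian \<omega> g u p = (\<Sum>X\<in>some_basis g. D (left_inv \<omega> p X) (left_inv \<omega> p X))"
  using lie_field_lie_field_eq[OF assms(1) assms(2) assms(3)]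
  by (simp add: sub_laplacian_def some_basis_def)

section \<open>Second derivatives and maps that intertwine the sub-Laplacians\<close>

lemma C2_mapE:
  assumes "C2_map f"
  obtains f' f2 where "\<And>p. (f has_derivative f' p) (at p)" "\<And>p v. ((\<lambda>q. f' q v) has_derivative f2 p v) (at p)"
proof -
  obtain f' where f': "\<And>p. (f has_derivative f' p) (at p)" "\<And>v. C1_map (\<lambda>p. f' p v)"
    using assms unfolding C2_map_def by blast
  have "\<forall>v. \<exists>d. \<forall>p. ((\<lambda>q. f' q v) has_derivative d p) (at p)"
    using f'(2) unfolding C1_map_def by blast
  then obtain d where "\<And>v p. ((\<lambda>q. f' q v) has_derivative d v p) (at p)" by metis
  then show ?thesis using that[OF f'(1), of "\<lambda>p v. d v p"] by blast
qed

lemma second_derivative_bilinear: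
  fixes u :: "'a::euclidean_space \<Rightarrow> real"
  assumes u: "\<And>p. (u has_derivative u' p) (at p)" and D: "\<And>v. ((\<lambda>q. u' q v) has_derivative D v) (at p)"
  shows "bilinear D"
  unfolding bilinear_def
proof (intro conjI allI)
  have lin: "linear (u' q)" for q using has_derivative_bounded_linear[OF u] by (rule bounded_linear.linear)
  show "linear (D v)" for v using has_derivative_bounded_linear[OF D] by (rule bounded_linear.linear)
  show "linear (\<lambda>v. D v w)" for w
  proof (rule linearI)
    fix v1 v2 c
    have "((\<lambda>q. u' q (v1 + v2)) has_derivative (\<lambda>w. D v1 w + D v2 w)) (at p)"
      unfolding linear_add[OF lin] by (intro has_derivative_add D)
    then show "D (v1 + v2) w = D v1 w + D v2 w" using has_derivative_unique[OF D] by metis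
    have "((\<lambda>q. u' q (c *\<^sub>R v1)) has_derivative (\<lambda>w. c *\<^sub>R D v1 w)) (at p)"
      unfolding linear_cmul[OF lin] by (intro has_derivative_scaleR_right D)
    then show "D (c *\<^sub>R v1) w = c *\<^sub>R D v1 w" using has_derivative_unique[OF D] by metis
  qed
qed

lemma C2_map_bounded_linear:
  fixes F :: "'a::euclidean_space \<Rightarrow> 'b::real_normed_vector"
  assumes "bounded_linear F" shows "C2_map F"
  unfolding C2_map_def C1_map_def
  by (rule exI[of _ "\<lambda>p. F"])
    (auto intro!: exI[of _ "\<lambda>p v. 0"] bounded_linear_imp_has_derivative assms)

text \<open>The linear map \<open>F\<close> built from \<open>L\<close> and \<open>\<mu>\<close>
  carries the left-invariant field of \<open>X\<close> to that of \<open>L X\<close>, and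
  \<open>L\<close> is \<open>sqrt c\<close> times an isometry; hence
  \<open>lam = sqrt c\<close>.\<close>

lemma similar_imp_laplacian_morphism:
  fixes \<omega>1 \<omega>2 g1 g2 :: "'v::euclidean_space \<Rightarrow> 'v \<Rightarrow> real"
  assumes \<omega>1: "symplectic_form \<omega>1" and \<omega>2: "symplectic_form \<omega>2"
    and g1: "scalar_product g1" and g2: "scalar_product g2" and "heis_similar \<omega>1 g1 \<omega>2 g2"
  shows "\<exists>(F :: 'v \<times> real \<Rightarrow> 'v \<times> real) lam. C2_map F \<and> lam > 0 \<and>
    (\<forall>u :: 'v \<times> real \<Rightarrow> real. C2_map u \<longrightarrow>
       sub_laplacian \<omega>2 g2 (u \<circ> F) = (\<lambda>p. lam\<^sup>2 * sub_laplacian \<omega>1 g1 u (F p)))"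
proof -
  obtain L \<mu> c where L: "linear L" "bij L" "c > 0" "\<And>v w. g1 (L v) (L w) = c * g2 v w"
    "\<And>v w. \<omega>1 (L v) (L w) = \<mu> * \<omega>2 v w"
    using assms(5) unfolding heis_similar_def by auto
  define F where "F p = (L (fst p), \<mu> * snd p)" for p
  have "linear F" by (rule linearI) (simp_all add: F_def linear_add[OF L(1)] linear_cmul[OF L(1)] algebra_simps)
  then have bF: "bounded_linear F" by (simp add: linear_conv_bounded_linear)
  have F': "(F has_derivative F) (at p)" for p using bF by (rule bounded_linear_imp_has_derivative)
  have push: "F (left_inv \<omega>2 p X) = left_inv \<omega>1 (F p) (L X)" for p X
    by (simp add: F_def left_inv_def L(5))
  let ?B = "some_basis g2"
  define S where "S X = (1 / sqrt c) *\<^sub>R L X" for X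
  have S: "linear S" unfolding S_def by (intro linear_compose_scale_right L)
  have gS: "g1 (S v) (S w) = g2 v w" for v w
    using L(3,4) by (simp add: S_def bilinear_simps[OF scalar_product_bilinear[OF g1]])
  have LS: "L X = sqrt c *\<^sub>R S X" for X using L(3) by (simp add: S_def)
  have "bij S" using similarity_bij[OF S g2, of 1 g1] gS scalar_product_bilinear[OF g1] by simp
  then have injS: "inj S" by (rule bij_is_inj)
  have B: "g_orthonormal_basis g2 ?B" by (rule some_basis[OF g2])
  then have SB: "g_orthonormal_basis g1 (S ` ?B)"
    using card_image[OF inj_on_subset[OF injS, of ?B]] injS
    by (auto simp: g_orthonormal_basis_def gS inj_eq)
  have "sub_laplacian \<omega>2 g2 (u \<circ> F) p = (sqrt c)\<^sup>2 * sub_laplacian \<omega>1 g1 u (F p)" if "C2_map u" for u p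
  proof -
    obtain u' u2 where u: "\<And>p. (u has_derivative u' p) (at p)" "\<And>p v. ((\<lambda>q. u' q v) has_derivative u2 p v) (at p)"
      using C2_mapE[OF \<open>C2_map u\<close>] by metis
    have uF: "((u \<circ> F) has_derivative (\<lambda>v. u' (F q) (F v))) (at q)" for q
      using has_derivative_compose[OF F' u(1)] by (simp add: o_def)
    have uF2: "((\<lambda>q. u' (F q) (F a)) has_derivative (\<lambda>b. u2 (F p) (F a) (F b))) (at p)" for a
      using has_derivative_compose[OF F' u(2)] .
    have D: "bilinear (u2 (F p))" by (rule second_derivative_bilinear[OF u])
    define \<beta> where "\<beta> X Y = u2 (F p) (left_inv \<omega>1 (F p) X) (left_inv \<omega>1 (F p) Y)" for X Y
    have \<beta>: "bilinear \<beta>"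
      unfolding \<beta>_def by (intro bilinear_pullback[OF D] left_inv_linear symplectic_form_bilinear[OF \<omega>1])
    have "sub_laplacian \<omega>2 g2 (u \<circ> F) p = (\<Sum>X\<in>?B. \<beta> (L X) (L X))"
      using sub_laplacian_eq[OF \<omega>2 uF uF2] by (simp add: push \<beta>_def)
    also have "\<dots> = c * (\<Sum>X\<in>?B. \<beta> (S X) (S X))"
      using L(3) by (simp add: LS bilinear_simps[OF \<beta>] sum_distrib_left mult.assoc[symmetric])
    also have "(\<Sum>X\<in>?B. \<beta> (S X) (S X)) = (\<Sum>Y\<in>S ` ?B. \<beta> Y Y)"
      using inj_on_subset[OF injS] by (simp add: sum.reindex)
    also have "\<dots> = (\<Sum>Y\<in>some_basis g1. \<beta> Y Y)"
      by (rule g_trace_basis_independent[OF g1 some_basis[OF g1] SB \<beta>])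
    also have "\<dots> = sub_laplacian \<omega>1 g1 u (F p)"
      using sub_laplacian_eq[OF \<omega>1 u(1) u(2)] by (simp add: \<beta>_def)
    finally show ?thesis using L(3) by (simp add: o_def)
  qed
  then show ?thesis
    using C2_map_bounded_linear[OF bF] L(3) by (intro exI[of _ F] exI[of _ "sqrt c"]) auto
qed

text \<open>The test function is the square of \<open>l\<close> recentred at \<open>F p\<close>. Its
  first derivative vanishes at \<open>F p\<close>, so the second derivatives of \<open>F\<close>
  drop out and only products of first derivatives survive on both sides.\<close>

lemma laplacian_test_square:
  fixes F :: "'v::euclidean_space \<times> real \<Rightarrow> 'v \<times> real" and l :: "'v \<times> real \<Rightarrow> real"
  assumes \<omega>1: "symplectic_form \<omega>1" and \<omega>2: "symplectic_form \<omega>2"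
    and F: "\<And>p. (F has_derivative f' p) (at p)" "\<And>p v. ((\<lambda>q. f' q v) has_derivative f2 p v) (at p)"
    and lap: "\<And>u :: 'v \<times> real \<Rightarrow> real. C2_map u \<Longrightarrow>
       sub_laplacian \<omega>2 g2 (u \<circ> F) = (\<lambda>p. lam\<^sup>2 * sub_laplacian \<omega>1 g1 u (F p))"
    and l: "bounded_linear l"
  shows "(\<Sum>X\<in>some_basis g2. (l (f' p (left_inv \<omega>2 p X)))\<^sup>2) = lam\<^sup>2 * (\<Sum>Y\<in>some_basis g1. (l (left_inv \<omega>1 (F p) Y))\<^sup>2)"
proof -
  define u where "u q = (l q - l (F p))\<^sup>2" for q
  have l': "(l has_derivative l) (at q)" for q using l by (rule bounded_linear_imp_has_derivative)
  have u: "(u has_derivative (\<lambda>v. 2 * (l q - l (F p)) * l v)) (at q)" for q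
    unfolding u_def by (auto intro!: derivative_eq_intros l' simp: fun_eq_iff algebra_simps)
  have u2: "((\<lambda>q. 2 * (l q - l (F p)) * l v) has_derivative (\<lambda>w. 2 * l w * l v)) (at q)" for v q
    by (auto intro!: derivative_eq_intros l' simp: fun_eq_iff)
  have "C1_map (\<lambda>q. 2 * (l q - l (F p)) * l v)" for v
    unfolding C1_map_def by (intro exI[of _ "\<lambda>q w. 2 * l w * l v"] conjI allI u2 continuous_on_const)
  then have "C2_map u"
    unfolding C2_map_def by (intro exI[of _ "\<lambda>q v. 2 * (l q - l (F p)) * l v"] conjI allI u)
  have lF: "((\<lambda>q. l (F q)) has_derivative (\<lambda>v. l (f' q v))) (at q)" for q
    using has_derivative_compose[OF F(1) l'] .
  have lf': "((\<lambda>q. l (f' q v)) has_derivative (\<lambda>w. l (f2 p v w))) (at p)" for v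
    using has_derivative_compose[OF F(2) l'] .
  have uF: "((u \<circ> F) has_derivative (\<lambda>v. 2 * (l (F q) - l (F p)) * l (f' q v))) (at q)" for q
    using has_derivative_compose[OF F(1) u] by (simp add: o_def)
  have uF2: "((\<lambda>q. 2 * (l (F q) - l (F p)) * l (f' q v)) has_derivative (\<lambda>w. 2 * l (f' p w) * l (f' p v))) (at p)" for v
    by (auto intro!: derivative_eq_intros lF lf' simp: fun_eq_iff)
  have "2 * (\<Sum>X\<in>some_basis g2. (l (f' p (left_inv \<omega>2 p X)))\<^sup>2) = sub_laplacian \<omega>2 g2 (u \<circ> F) p"
    using sub_laplacian_eq[OF \<omega>2 uF uF2] by (simp add: sum_distrib_left power2_eq_square mult.assoc)
  also have "\<dots> = lam\<^sup>2 * sub_laplacian \<omega>1 g1 u (F p)" using lap[OF \<open>C2_map u\<close>] by simp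
  also have "\<dots> = 2 * (lam\<^sup>2 * (\<Sum>Y\<in>some_basis g1. (l (left_inv \<omega>1 (F p) Y))\<^sup>2))"
    using sub_laplacian_eq[OF \<omega>1 u u2] by (simp add: sum_distrib_left power2_eq_square mult.assoc mult.left_commute)
  finally show ?thesis by simp
qed

text \<open>The hypothesis says that the adjoint of \<open>N\<close> preserves norms. In finite
  dimension such an adjoint is onto, so \<open>N\<close> is its inverse and orthogonal as
  well.\<close>

lemma coisometry_isometry:
  fixes N :: "'v::euclidean_space \<Rightarrow> 'v"
  assumes N: "linear N" and "\<And>x. (\<Sum>b\<in>Basis. (x \<bullet> N b)\<^sup>2) = x \<bullet> x"
  shows "N v \<bullet> N w = v \<bullet> w"
proof -
  define M where "M = adjoint N"
  have M: "linear M" "\<And>x y. M x \<bullet> y = x \<bullet> N y" using N by (auto simp: M_def adjoint_linear adjoint_clauses)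
  have "M x \<bullet> M x = x \<bullet> x" for x
  proof -
    have "M x \<bullet> M x = (\<Sum>b\<in>Basis. (M x \<bullet> b) * (M x \<bullet> b))" by (rule euclidean_inner)
    also have "\<dots> = (\<Sum>b\<in>Basis. (x \<bullet> N b)\<^sup>2)" by (simp only: M(2) power2_eq_square)
    finally show ?thesis using assms(2) by simp
  qed
  then have ot: "orthogonal_transformation M" using M(1) by (simp add: orthogonal_transformation norm_eq_sqrt_inner)
  then have Mi: "M x \<bullet> M y = x \<bullet> y" for x y by (simp add: orthogonal_transformation_def)
  have inner_NM: "x \<bullet> N (M y) = x \<bullet> y" for x y by (simp add: Mi flip: M(2))
  have NM: "N (M y) = y" for y by (rule vector_eq_ldot[THEN iffD1]) (simp add: inner_NM)
  have "surj M" by (rule orthogonal_transformation_surj[OF ot])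
  then obtain a b where "v = M a" "w = M b" by (metis surjD)
  then show ?thesis by (simp add: NM Mi)
qed

text \<open>Squares of affine functions detect the principal symbol; this makes the differential of \<open>F\<close> horizontal
  and conformal, and differentiating horizontality once more at \<open>0\<close> compares the two brackets.\<close>
lemma laplacian_morphism_imp_similar:
  fixes \<omega>1 \<omega>2 g1 g2 :: "'v::euclidean_space \<Rightarrow> 'v \<Rightarrow> real" and F :: "'v \<times> real \<Rightarrow> 'v \<times> real"
  assumes \<omega>1: "symplectic_form \<omega>1" and \<omega>2: "symplectic_form \<omega>2"
    and g1: "scalar_product g1" and g2: "scalar_product g2" and "C2_map F" "lam > 0"
    and lap: "\<And>u :: 'v \<times> real \<Rightarrow> real. C2_map u \<Longrightarrow>
       sub_laplacian \<omega>2 g2 (u \<circ> F) = (\<lambda>p. lam\<^sup>2 * sub_laplacian \<omega>1 g1 u (F p))"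
  shows "heis_similar \<omega>1 g1 \<omega>2 g2"
proof -
  obtain f' f2 where F: "\<And>p. (F has_derivative f' p) (at p)" "\<And>p v. ((\<lambda>q. f' q v) has_derivative f2 p v) (at p)"
    using C2_mapE[OF \<open>C2_map F\<close>] by metis
  note bil1 = symplectic_form_bilinear[OF \<omega>1] and bil2 = symplectic_form_bilinear[OF \<omega>2]
  note b1 = bilinear_simps[OF bil1] and b2 = bilinear_simps[OF bil2]
  have lf': "linear (f' p)" for p using has_derivative_bounded_linear[OF F(1)] by (rule bounded_linear.linear)
  have test: "(\<Sum>X\<in>some_basis g2. (l (f' p (left_inv \<omega>2 p X)))\<^sup>2) = lam\<^sup>2 * (\<Sum>Y\<in>some_basis g1. (l (left_inv \<omega>1 (F p) Y))\<^sup>2)"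
    if "linear l" for l p
    using laplacian_test_square[OF \<omega>1 \<omega>2 F lap, of l p] that by (simp add: linear_conv_bounded_linear)
  \<comment> \<open>The contact form: its kernel at a point over \<open>x\<close> is the horizontal
    space there.\<close>
  define th where "th x a = snd a - \<omega>1 x (fst a) / 2" for x and a :: "'v \<times> real"
  have th: "linear (th x)" for x by (rule linearI) (simp_all add: th_def b1 algebra_simps add_divide_distrib)
  have horizontal: "th (fst (F p)) (f' p (left_inv \<omega>2 p v)) = 0" for p v
  proof -
    have lin: "linear (\<lambda>v. th (fst (F p)) (f' p (left_inv \<omega>2 p v)))"
      using linear_compose[OF linear_compose[OF left_inv_linear[OF bil2] lf'] th] by (simp add: o_def)
    \<comment> \<open>With the contact form as test functional the right-hand side of
      \<open>test\<close> vanishes, hence every square on the left does.\<close>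
    have "th (fst (F p)) (left_inv \<omega>1 (F p) Y) = 0" for Y by (simp add: th_def left_inv_def)
    then have "(\<Sum>X\<in>some_basis g2. (th (fst (F p)) (f' p (left_inv \<omega>2 p X)))\<^sup>2) = 0" using test[OF th] by simp
    then have zero: "th (fst (F p)) (f' p (left_inv \<omega>2 p X)) = 0" if "X \<in> some_basis g2" for X
      using that some_basis[OF g2] by (subst (asm) sum_nonneg_eq_0_iff) (auto simp: g_orthonormal_basis_def)
    have "v = (\<Sum>X\<in>some_basis g2. g2 v X *\<^sub>R X)" by (rule g_orthonormal_basis_expansion(1)[OF g2 some_basis[OF g2]])
    then have "th (fst (F p)) (f' p (left_inv \<omega>2 p v)) = (\<Sum>X\<in>some_basis g2. g2 v X *\<^sub>R th (fst (F p)) (f' p (left_inv \<omega>2 p X)))"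
      using linear_sum[OF lin, of "\<lambda>X. g2 v X *\<^sub>R X" "some_basis g2"] linear_cmul[OF lin] by simp
    then show ?thesis using zero by simp
  qed
  define L where "L v = fst (f' 0 (v, 0))" for v
  have left0: "left_inv \<omega> 0 v = (v, 0)" if "bilinear \<omega>" for \<omega> and v :: 'v by (simp add: left_inv_def bilinear_lzero[OF that])
  have "linear (\<lambda>v :: 'v. (v, 0 :: real))" by (rule linearI) auto
  then have L: "linear L"
    using linear_compose[OF linear_compose[OF _ lf'[of 0]] linear_fst] by (simp add: L_def[abs_def] o_def)
  define c where "c = lam\<^sup>2"
  have c: "c > 0" using \<open>lam > 0\<close> by (simp add: c_def)
  \<comment> \<open>Testing with \<open>g1 x\<close> after the projection: \<open>L\<close> composed
    with its adjoint is \<open>c\<close> times the identity.\<close>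
  have trace: "(\<Sum>X\<in>some_basis g2. (g1 x (L X))\<^sup>2) = c * g1 x x" for x
  proof -
    have "linear (\<lambda>a :: 'v \<times> real. g1 x (fst a))"
      using linear_compose[OF linear_fst, of "g1 x"] scalar_product_bilinear[OF g1] by (simp add: bilinear_def o_def)
    from test[OF this, of 0] show ?thesis
      using g_orthonormal_basis_expansion(2)[OF g1 some_basis[OF g1], of x x]
      by (simp add: L_def left0[OF bil2] c_def power2_eq_square) (simp add: left_inv_def)
  qed
  obtain T2 :: "'v \<Rightarrow> 'v" where T2: "linear T2" "bij T2" "\<And>v w. g2 (T2 v) (T2 w) = v \<bullet> w" "bij_betw T2 Basis (some_basis g2)"
    using g_orthonormal_basis_frame[OF g2 some_basis[OF g2]] by metis
  obtain T1 :: "'v \<Rightarrow> 'v" where T1: "linear T1" "bij T1" "\<And>v w. g1 (T1 v) (T1 w) = v \<bullet> w"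
    using scalar_product_frame[OF g1] by metis
  have T1I: "T1 (inv T1 x) = x" for x using T1(2) by (simp add: bij_is_surj surj_f_inv_f)
  have IT1: "inv T1 (T1 x) = x" for x using T1(2) by (simp add: bij_is_inj)
  have lI: "linear (inv T1)"
    by (intro linearI) (metis T1I IT1 linear_add[OF T1(1)], metis T1I IT1 linear_cmul[OF T1(1)])
  \<comment> \<open>\<open>L\<close> divided by \<open>sqrt c\<close>, in orthonormal frames;
    \<open>trace\<close> then says that the adjoint of \<open>N\<close> preserves norms.\<close>
  define N where "N v = (1 / sqrt c) *\<^sub>R inv T1 (L (T2 v))" for v
  have N: "linear N"
    unfolding N_def using linear_compose[OF linear_compose[OF T2(1) L] lI]
    by (intro linear_compose_scale_right) (simp add: o_def)
  have xN: "x \<bullet> N v = (1 / sqrt c) * g1 (T1 x) (L (T2 v))" for x v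
    by (simp add: N_def T1(3)[symmetric] linear_cmul[OF T1(1)] T1I bilinear_simps[OF scalar_product_bilinear[OF g1]])
  have "(\<Sum>b\<in>Basis. (x \<bullet> N b)\<^sup>2) = x \<bullet> x" for x
  proof -
    have "(\<Sum>b\<in>Basis. (x \<bullet> N b)\<^sup>2) = (1 / c) * (\<Sum>b\<in>Basis. (g1 (T1 x) (L (T2 b)))\<^sup>2)"
      using c by (simp add: xN power_mult_distrib power_divide sum_distrib_left)
    also have "(\<Sum>b\<in>Basis. (g1 (T1 x) (L (T2 b)))\<^sup>2) = (\<Sum>X\<in>some_basis g2. (g1 (T1 x) (L X))\<^sup>2)"
      using sum.reindex_bij_betw[OF T2(4), of "\<lambda>X. (g1 (T1 x) (L X))\<^sup>2"] .
    finally show ?thesis using c by (simp add: trace T1(3))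
  qed
  then have Ni: "N v \<bullet> N w = v \<bullet> w" for v w by (rule coisometry_isometry[OF N])
  have conf: "g1 (L v) (L w) = c * g2 v w" for v w
  proof -
    obtain x y where xy: "v = T2 x" "w = T2 y" using T2(2) by (metis bij_pointE)
    have "L (T2 z) = T1 (sqrt c *\<^sub>R N z)" for z using c by (simp add: N_def T1I)
    then show ?thesis using c by (simp add: xy T1(3) T2(3) Ni)
  qed
  have bL: "bij L" by (rule similarity_bij[OF L g2 c conf scalar_product_bilinear[OF g1]])
  define x0 where "x0 = fst (F 0)"
  define \<mu> where "\<mu> = th x0 (f' 0 (0, 1))"
  have bth: "(th x has_derivative th x) (at a)" for x a
    using th by (intro bounded_linear_imp_has_derivative) (simp add: linear_conv_bounded_linear)
  have d1: "((\<lambda>q. th x0 (F q)) has_derivative (\<lambda>v. th x0 (f' q v))) (at q)" for q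
    using has_derivative_compose[OF F(1) bth] .
  have d2: "((\<lambda>q. th x0 (f' q v)) has_derivative (\<lambda>w. th x0 (f2 q v w))) (at q)" for v q
    using has_derivative_compose[OF F(2) bth] .
  have symm: "th x0 (f2 0 v w) = th x0 (f2 0 w v)" for v w
    by (rule second_derivative_symmetric[OF d1 d2 d2])
  \<comment> \<open>Derivative at 0, along the line in direction \<open>w\<close>, of the statement
    that \<open>f' p\<close> maps the field of \<open>v\<close> to horizontal vectors. The three
    terms come from the second derivative of \<open>F\<close>, from the turning of the field, and
    from the turning of the contact form at \<open>F p\<close>.\<close>
  have key: "th x0 (f2 0 (v, 0) (w, 0)) + \<omega>2 w v / 2 * \<mu> = \<omega>1 (L w) (L v) / 2" for v w
  proof -
    let ?p = "\<lambda>t::real. t *\<^sub>R (w, 0::real)"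
    let ?A = "\<lambda>t. f' (?p t) (left_inv \<omega>2 (?p t) v)"
    have A: "?A t = f' (?p t) (v, 0) + (t * (\<omega>2 w v / 2)) *\<^sub>R f' (?p t) (0, 1)" for t
    proof -
      have "left_inv \<omega>2 (?p t) v = (v, 0) + (t * (\<omega>2 w v / 2)) *\<^sub>R (0, 1)" by (simp add: left_inv_def b2)
      then show ?thesis by (simp only: linear_add[OF lf'] linear_cmul[OF lf'])
    qed
    have p': "(?p has_derivative (\<lambda>r. r *\<^sub>R (w, 0))) (at 0)" by (auto intro!: derivative_eq_intros)
    have dF: "((\<lambda>t. F (?p t)) has_derivative (\<lambda>r. f' 0 (r *\<^sub>R (w, 0)))) (at 0)"
      using has_derivative_compose[OF p' F(1)] by (simp add: zero_prod_def)
    have df: "((\<lambda>t. f' (?p t) a) has_derivative (\<lambda>r. f2 0 a (r *\<^sub>R (w, 0)))) (at 0)" for a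
      using has_derivative_compose[OF p' F(2)] by (simp add: zero_prod_def)
    have dA: "(?A has_derivative (\<lambda>r. f2 0 (v, 0) (r *\<^sub>R (w, 0)) + (r * (\<omega>2 w v / 2)) *\<^sub>R f' 0 (0, 1))) (at 0)"
    proof -
      have "((\<lambda>t::real. t * (\<omega>2 w v / 2)) has_derivative (\<lambda>r. r * (\<omega>2 w v / 2))) (at 0)"
        by (auto intro!: derivative_eq_intros)
      from has_derivative_add[OF df[of "(v, 0)"] has_derivative_scaleR[OF this df[of "(0, 1)"]]]
      show ?thesis unfolding A by (simp flip: zero_prod_def)
    qed
    have bb: "bounded_bilinear \<omega>1" using bil1 by (simp add: bilinear_conv_bounded_bilinear)
    have der: "((\<lambda>t. snd (?A t) - \<omega>1 (fst (F (?p t))) (fst (?A t)) / 2) has_derivative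
      (\<lambda>r. snd (f2 0 (v, 0) (r *\<^sub>R (w, 0)) + (r * (\<omega>2 w v / 2)) *\<^sub>R f' 0 (0, 1)) -
        (\<omega>1 (fst (F (?p 0))) (fst (f2 0 (v, 0) (r *\<^sub>R (w, 0)) + (r * (\<omega>2 w v / 2)) *\<^sub>R f' 0 (0, 1)))
         + \<omega>1 (fst (f' 0 (r *\<^sub>R (w, 0)))) (fst (?A 0))) / 2)) (at 0)"
      by (intro has_derivative_diff has_derivative_snd dA
          bounded_linear.has_derivative[OF bounded_linear_divide] bounded_bilinear.FDERIV[OF bb] has_derivative_fst dF)
    have const: "(\<lambda>t. snd (?A t) - \<omega>1 (fst (F (?p t))) (fst (?A t)) / 2) = (\<lambda>t. 0)"
      by (rule ext) (rule horizontal[unfolded th_def])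
    have zero: "(\<lambda>r. snd (f2 0 (v, 0) (r *\<^sub>R (w, 0)) + (r * (\<omega>2 w v / 2)) *\<^sub>R f' 0 (0, 1)) -
        (\<omega>1 (fst (F (?p 0))) (fst (f2 0 (v, 0) (r *\<^sub>R (w, 0)) + (r * (\<omega>2 w v / 2)) *\<^sub>R f' 0 (0, 1)))
         + \<omega>1 (fst (f' 0 (r *\<^sub>R (w, 0)))) (fst (?A 0))) / 2) = (\<lambda>r. 0)"
      by (rule has_derivative_unique[OF der[unfolded const] has_derivative_const])
    have A0: "fst (?A 0) = L v" by (simp only: scaleR_zero_left left0[OF bil2] L_def)
    from fun_cong[OF zero, of 1] have "th x0 (f2 0 (v, 0) (w, 0) + (\<omega>2 w v / 2) *\<^sub>R f' 0 (0, 1)) = \<omega>1 (L w) (L v) / 2"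
      unfolding A0 scaleR_zero_left by (simp add: th_def x0_def L_def left0[OF bil2] add_divide_distrib)
    then show ?thesis by (simp add: linear_add[OF th] linear_cmul[OF th] \<mu>_def)
  qed
  \<comment> \<open>Exchanging \<open>v\<close> and \<open>w\<close> and subtracting cancels the
    symmetric second derivative and leaves the two brackets.\<close>
  have form: "\<omega>1 (L v) (L w) = \<mu> * \<omega>2 v w" for v w
    using key[of v w] key[of w v] symm[of "(v, 0)" "(w, 0)"]
      symplectic_form_skew[OF \<omega>1, of "L w" "L v"] symplectic_form_skew[OF \<omega>2, of w v]
    by (simp add: algebra_simps)
  have "\<mu> \<noteq> 0"
  proof
    assume "\<mu> = 0"
    obtain v :: 'v where v: "v \<noteq> 0" using nonempty_Basis nonzero_Basis by blast
    have "\<omega>1 (L v) w = 0" for w using form[of v] bL \<open>\<mu> = 0\<close> by (metis bij_pointE mult_zero_left)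
    then have "L v = 0" by (rule symplectic_form_nondegenerate[OF \<omega>1])
    then show False using v L bL by (metis bij_is_inj linear_injective_0)
  qed
  then show ?thesis unfolding heis_similar_def using L bL c conf form by blast
qed

theorem theorem5p5:
  fixes \<omega>1 \<omega>2 g1 g2 :: "'v::euclidean_space \<Rightarrow> 'v \<Rightarrow> real"
  assumes "symplectic_form \<omega>1" and "symplectic_form \<omega>2"
    and "scalar_product g1" and "scalar_product g2"
  shows "(heis_isometric \<omega>1 g1 \<omega>2 g2 \<longleftrightarrow>
            (\<exists>\<rho>>0. sympl_spec \<omega>1 g1 = map (\<lambda>r. \<rho> * r) (sympl_spec \<omega>2 g2)))
       \<and> ((\<exists>(F :: 'v \<times> real \<Rightarrow> 'v \<times> real) lam. C2_map F \<and> lam > 0 \<and>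
            (\<forall>u :: 'v \<times> real \<Rightarrow> real. C2_map u \<longrightarrow>
               sub_laplacian \<omega>2 g2 (u \<circ> F) = (\<lambda>p. lam\<^sup>2 * sub_laplacian \<omega>1 g1 u (F p))))
          \<longleftrightarrow> (\<exists>\<rho>>0. sympl_spec \<omega>1 g1 = map (\<lambda>r. \<rho> * r) (sympl_spec \<omega>2 g2)))"
  using heis_isometric_iff_similar[OF assms] heis_similar_iff_spec[OF assms]
    similar_imp_laplacian_morphism[OF assms] laplacian_morphism_imp_similar[OF assms]
  by blast

end
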